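(* Let $\mathfrak{g}$ be a finite dimensional complex simple Lie algebra of dimension $d$, let $\ell\in\mathbb{C}$ with $\ell\ne -h^\vee$, and fix an orthonormal basis $\{u^1,\dots,u^d\}$ of $\mathfrak{g}$. The action of $\operatorname{Aut}(\mathfrak{g})$ on $\operatorname{Sc}(V_{\widehat{\mathfrak{g}}}(\ell,0),\omega)$ is given as follows: for each $\omega_A\in \operatorname{Sc}(V_{\widehat{\mathfrak{g}}}(\ell,0),\omega)$ and each $\sigma\in\operatorname{Aut}(\mathfrak{g})$, $$\sigma(\omega_A)=\omega_B\in \operatorname{Sc}(V_{\widehat{\mathfrak{g}}}(\ell,0),\omega),\qquad B=gAg^{tr},$$ where $g$ is the matrix of $\sigma$ with respect to the basis $\{u^1,\dots,u^d\}$.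
   Context: $\langle\cdot,\cdot\rangle$ is the normalized Killing form on $\mathfrak{g}$ (orthonormality is with respect to it) and $h^\vee$ is the dual Coxeter number. $\widehat{\mathfrak{g}}=\mathfrak{g}\otimes\mathbb{C}[t,t^{-1}]\oplus\mathbb{C}K$ with $a(n)=a\otimes t^n$, $K$ central, $[a(n),b(m)]=[a,b](n+m)+n\delta_{n+m,0}\langle a,b\rangle K$. $V=V_{\widehat{\mathfrak{g}}}(\ell,0)=U(\widehat{\mathfrak{g}})\otimes_{U(\mathfrak{g}\otimes\mathbb{C}[t]\oplus\mathbb{C}K)}\mathbb{C}_\ell$ is the universal affine vertex operator algebra of level $\ell$, with $Y(a(-1)\mathbf{1},z)=\sum_n a(n)z^{-n-1}$ and conformal vector $\omega=\frac{1}{2(\ell+h^\vee)}\sum_i u^i(-1)u^i(-1)\mathbf{1}$; $L(n)$ denotes the modes of $Y(\omega,z)=\sum_n L(n)z^{-n-2}$. Semi-conformal vectors: write $Y(v,z)=\sum_n v_nz^{-n-1}$. A vector $\omega'\in V$ is semi-conformal in $(V,\omega)$ if there is a vertex subalgebra $U\subseteq V$ such that $(U,\omega')$ is a vertex operator algebra with conformal vector $\omega'$ and $\omega'_n|_U=\omega_n|_U$ for all $n\ge 0$. $\operatorname{Sc}(V,\omega)$ is the set of semi-conformal vectors. Notation $\omega_A$: every semi-conformal vector of $V$ lies in $\operatorname{Ker}L(1)\cap V_2$ and is uniquely of the form $\omega_A=\sum_{i,j}a_{ij}u^i(-1)u^j(-1)\mathbf{1}$ with $A=(a_{ij})$ a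 complex symmetric $d\times d$ matrix. $\sigma\in\operatorname{Aut}(\mathfrak{g})$ acts on $V$ by $\sigma(a^{1}(-n_1)\cdots a^{r}(-n_r)\mathbf{1})=\sigma(a^{1})(-n_1)\cdots\sigma(a^{r})(-n_r)\mathbf{1}$; its matrix $g=(g_{ij})$ is defined by $\sigma(u^j)=\sum_i g_{ij}u^i$. *)

theory Defs
  imports "HOL-Analysis.Analysis" "HOL-Library.Poly_Mapping"
begin

section \<open>Complex vector spaces\<close>

class scaleC =
  fixes scaleC :: "complex \<Rightarrow> 'a \<Rightarrow> 'a"  (infixr \<open>*\<^sub>C\<close> 75)

class complex_vector = scaleC + ab_group_add +
  assumes scaleC_add_right: "c *\<^sub>C (x + y) = c *\<^sub>C x + c *\<^sub>C y"
    and scaleC_add_left: "(b + c) *\<^sub>C x = b *\<^sub>C x + c *\<^sub>C x"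
    and scaleC_scaleC: "b *\<^sub>C c *\<^sub>C x = (b * c) *\<^sub>C x"
    and scaleC_one: "1 *\<^sub>C x = x"

global_interpretation cvec: vector_space "scaleC :: complex \<Rightarrow> 'a \<Rightarrow> 'a::complex_vector"
  by unfold_locales
    (simp_all add: scaleC_add_right scaleC_add_left scaleC_scaleC scaleC_one)

abbreviation clinear :: "('a::complex_vector \<Rightarrow> 'b::complex_vector) \<Rightarrow> bool"
  where "clinear \<equiv> Vector_Spaces.linear scaleC scaleC"

instantiation complex :: complex_vector
begin
definition scaleC_complex :: "complex \<Rightarrow> complex \<Rightarrow> complex"
  where "scaleC_complex c x = c * x"
instance
  by standard (simp_all add: scaleC_complex_def algebra_simps)
end

instantiation prod :: (complex_vector, complex_vector) complex_vector
begin
definition scaleC_prod :: "complex \<Rightarrow> 'a \<times> 'b \<Rightarrow> 'a \<times> 'b"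
  where "scaleC_prod c p = (c *\<^sub>C fst p, c *\<^sub>C snd p)"
instance
  by standard
    (simp_all add: scaleC_prod_def plus_prod_def
      scaleC_add_right scaleC_add_left scaleC_scaleC scaleC_one)
end

instantiation poly_mapping :: (type, complex_vector) complex_vector
begin
definition scaleC_poly_mapping :: "complex \<Rightarrow> ('a \<Rightarrow>\<^sub>0 'b) \<Rightarrow> ('a \<Rightarrow>\<^sub>0 'b)"
  where "scaleC_poly_mapping c f = Poly_Mapping.map (scaleC c) f"

lemma lookup_scaleC: "Poly_Mapping.lookup (c *\<^sub>C f) k = c *\<^sub>C Poly_Mapping.lookup f k"
  for f :: "'a \<Rightarrow>\<^sub>0 'b"
  by (simp add: scaleC_poly_mapping_def map.rep_eq when_def)

instance
  by standard
    (rule poly_mapping_eqI,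
      simp add: lookup_scaleC lookup_add
        scaleC_add_right scaleC_add_left scaleC_scaleC scaleC_one)+
end

text \<open>The trace of an endomorphism of a finite dimensional space; the value does not depend on
  the basis chosen by \<^term>\<open>cvec.extend_basis {}\<close>.\<close>

definition ctrace :: "('a::complex_vector \<Rightarrow> 'a) \<Rightarrow> complex"
  where "ctrace f =
    (let B = cvec.extend_basis {} in \<Sum>b\<in>B. cvec.representation B (f b) b)"


section \<open>Finite dimensional complex simple Lie algebras\<close>

class complex_lie_algebra = complex_vector +
  fixes lie :: "'a \<Rightarrow> 'a \<Rightarrow> 'a"
  assumes lie_add_left: "lie (x + y) z = lie x z + lie y z"
    and lie_add_right: "lie x (y + z) = lie x y + lie x z"
    and lie_scaleC_left: "lie (c *\<^sub>C x) y = c *\<^sub>C lie x y"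
    and lie_scaleC_right: "lie x (c *\<^sub>C y) = c *\<^sub>C lie x y"
    and lie_self: "lie x x = 0"
    and jacobi: "lie x (lie y z) + lie y (lie z x) + lie z (lie x y) = 0"

class simple_lie_algebra = complex_lie_algebra +
  assumes finite_dimensional: "\<exists>B. finite B \<and> (\<forall>x. \<exists>f. x = (\<Sum>b\<in>B. f b *\<^sub>C b))"
    and non_abelian: "\<exists>x y. lie x y \<noteq> 0"
    and no_proper_ideal:
      "0 \<in> I \<Longrightarrow> (\<And>x y. x \<in> I \<Longrightarrow> y \<in> I \<Longrightarrow> x + y \<in> I) \<Longrightarrow>
        (\<And>c x. x \<in> I \<Longrightarrow> c *\<^sub>C x \<in> I) \<Longrightarrow> (\<And>x y. y \<in> I \<Longrightarrow> lie x y \<in> I) \<Longrightarrow>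
        I = {0} \<or> I = UNIV"

definition lie_automorphism :: "('g::complex_lie_algebra \<Rightarrow> 'g) \<Rightarrow> bool"
  where "lie_automorphism \<sigma> \<longleftrightarrow>
    clinear \<sigma> \<and> bij \<sigma> \<and> (\<forall>x y. \<sigma> (lie x y) = lie (\<sigma> x) (\<sigma> y))"

definition killing_form :: "'g::complex_lie_algebra \<Rightarrow> 'g \<Rightarrow> complex"
  where "killing_form x y = ctrace (\<lambda>z. lie x (lie y z))"

text \<open>For a semisimple Lie algebra over the complex numbers the Cartan subalgebras are the
  maximal toral subalgebras, i.e. the maximal subalgebras consisting of elements \<open>x\<close> for which
  \<open>ad x\<close> is diagonalizable.\<close>

definition lie_subalgebra :: "'g::complex_lie_algebra set \<Rightarrow> bool"
  where "lie_subalgebra H \<longleftrightarrow> cvec.subspace H \<and> (\<forall>x\<in>H. \<forall>y\<in>H. lie x y \<in> H)"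

definition ad_diagonalizable :: "'g::complex_lie_algebra \<Rightarrow> bool"
  where "ad_diagonalizable x \<longleftrightarrow> cvec.span {y. \<exists>c. lie x y = c *\<^sub>C y} = UNIV"

definition toral :: "'g::complex_lie_algebra set \<Rightarrow> bool"
  where "toral H \<longleftrightarrow> lie_subalgebra H \<and> (\<forall>x\<in>H. ad_diagonalizable x)"

definition cartan_subalgebra :: "'g::complex_lie_algebra set \<Rightarrow> bool"
  where "cartan_subalgebra H \<longleftrightarrow> toral H \<and> (\<forall>H'. toral H' \<longrightarrow> H \<subseteq> H' \<longrightarrow> H' = H)"

text \<open>A linear form on \<open>H\<close> is represented by the function on the whole Lie algebra that extends it
  by \<open>0\<close> outside \<open>H\<close>, so that distinct functions are distinct forms. Elements of \<open>roots H\<close> are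
  automatically linear on \<open>H\<close>, since their root spaces are nonzero.\<close>

definition root_space :: "'g::complex_lie_algebra set \<Rightarrow> ('g \<Rightarrow> complex) \<Rightarrow> 'g set"
  where "root_space H \<alpha> = {x. \<forall>h\<in>H. lie h x = \<alpha> h *\<^sub>C x}"

definition roots :: "'g::complex_lie_algebra set \<Rightarrow> ('g \<Rightarrow> complex) set"
  where "roots H =
    {\<alpha>. (\<forall>x. x \<notin> H \<longrightarrow> \<alpha> x = 0) \<and> (\<exists>h\<in>H. \<alpha> h \<noteq> 0) \<and> root_space H \<alpha> \<noteq> {0}}"

definition positive_system :: "'g::complex_lie_algebra set \<Rightarrow> ('g \<Rightarrow> complex) set \<Rightarrow> bool"
  where "positive_system H P \<longleftrightarrow> P \<subseteq> roots H
    \<and> (\<forall>\<alpha>\<in>roots H. (\<alpha> \<in> P) \<noteq> ((\<lambda>x. - \<alpha> x) \<in> P))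
    \<and> (\<forall>\<alpha>\<in>P. \<forall>\<beta>\<in>P. (\<lambda>x. \<alpha> x + \<beta> x) \<in> roots H \<longrightarrow> (\<lambda>x. \<alpha> x + \<beta> x) \<in> P)"

definition highest_root ::
    "'g::complex_lie_algebra set \<Rightarrow> ('g \<Rightarrow> complex) set \<Rightarrow> ('g \<Rightarrow> complex) \<Rightarrow> bool"
  where "highest_root H P \<theta> \<longleftrightarrow> \<theta> \<in> P \<and> (\<forall>\<alpha>\<in>P. (\<lambda>x. \<theta> x + \<alpha> x) \<notin> roots H)"

definition is_coroot :: "'g::complex_lie_algebra set \<Rightarrow> ('g \<Rightarrow> complex) \<Rightarrow> 'g \<Rightarrow> bool"
  where "is_coroot H \<alpha> h \<longleftrightarrow> h \<in> H \<and> \<alpha> h = 2 \<and>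
    h \<in> cvec.span {lie x y | x y. x \<in> root_space H \<alpha> \<and> y \<in> root_space H (\<lambda>z. - \<alpha> z)}"

text \<open>The normalized form is the multiple \<open>\<langle>\<cdot>,\<cdot>\<rangle> = c \<kappa>\<close> of the Killing form \<open>\<kappa>\<close> for which the
  highest (equivalently: any long) root satisfies \<open>\<langle>\<theta>,\<theta>\<rangle> = 2\<close>. Here \<open>t\<close> is the element of \<open>H\<close>
  that corresponds to \<open>\<theta>\<close> under \<open>\<langle>\<cdot>,\<cdot>\<rangle>\<close>, whence \<open>\<langle>\<theta>,\<theta>\<rangle> = \<langle>t,t\<rangle>\<close>. Neither \<open>c\<close> nor the dual
  Coxeter number \<open>h\<^sup>\<or> = 1 + \<langle>\<rho>,\<theta>\<^sup>\<or>\<rangle>\<close>, with \<open>\<rho>\<close> half the sum of the positive roots, depends on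
  the choice of the Cartan subalgebra and of the positive system.\<close>

definition normalized_killing_form :: "'g::simple_lie_algebra \<Rightarrow> 'g \<Rightarrow> complex"
  where "normalized_killing_form x y =
    (THE c. \<exists>(H::'g set) P \<theta> t.
        cartan_subalgebra H \<and> positive_system H P \<and> highest_root H P \<theta> \<and> t \<in> H
        \<and> (\<forall>h\<in>H. c * killing_form t h = \<theta> h) \<and> c * killing_form t t = 2)
      * killing_form x y"

definition dual_coxeter_number :: "'g::simple_lie_algebra itself \<Rightarrow> complex"
  where "dual_coxeter_number _ =
    (THE c. \<exists>(H::'g set) P \<theta> h.
        cartan_subalgebra H \<and> positive_system H P \<and> highest_root H P \<theta> \<and> is_coroot H \<theta> h
        \<and> c = 1 + (1/2) * (\<Sum>\<alpha>\<in>P. \<alpha> h))"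

definition orthonormal_basis :: "('n::finite \<Rightarrow> 'g::simple_lie_algebra) \<Rightarrow> bool"
  where "orthonormal_basis u \<longleftrightarrow> cvec.span (range u) = UNIV
    \<and> (\<forall>i j. normalized_killing_form (u i) (u j) = (if i = j then 1 else 0))"


section \<open>Affine Lie algebras and induced modules\<close>

text \<open>\<open>\<gg> \<otimes> \<complex>[t,t\<^sup>-\<^sup>1] \<oplus> \<complex>K\<close>: an element of \<open>\<gg> \<otimes> \<complex>[t,t\<^sup>-\<^sup>1]\<close> is a finitely supported
  family of elements of \<open>\<gg>\<close> indexed by the exponents of \<open>t\<close>; the second component is the coefficient
  of \<open>K\<close>.\<close>

type_synonym 'g affine = "(int \<Rightarrow>\<^sub>0 'g) \<times> complex"

definition loop :: "'g::complex_lie_algebra \<Rightarrow> int \<Rightarrow> 'g affine"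
  where "loop a n = (Poly_Mapping.single n a, 0)"

definition affine_bracket :: "'g::simple_lie_algebra affine \<Rightarrow> 'g affine \<Rightarrow> 'g affine"
  where "affine_bracket X Y =
    ((\<Sum>n\<in>Poly_Mapping.keys (fst X). \<Sum>m\<in>Poly_Mapping.keys (fst Y).
        Poly_Mapping.single (n + m)
          (lie (Poly_Mapping.lookup (fst X) n) (Poly_Mapping.lookup (fst Y) m))),
     (\<Sum>n\<in>Poly_Mapping.keys (fst X).
        of_int n * normalized_killing_form
          (Poly_Mapping.lookup (fst X) n) (Poly_Mapping.lookup (fst Y) (- n))))"

text \<open>The subalgebra \<open>\<gg> \<otimes> \<complex>[t] \<oplus> \<complex>K\<close> and its character that kills \<open>\<gg> \<otimes> \<complex>[t]\<close> and maps
  \<open>K\<close> to \<open>\<l>\<close>; this character is the module \<open>\<complex>\<^sub>\<l>\<close>.\<close>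

definition affine_nonneg :: "'g::simple_lie_algebra affine set"
  where "affine_nonneg = {X. \<forall>n\<in>Poly_Mapping.keys (fst X). n \<ge> 0}"

definition level_character :: "complex \<Rightarrow> 'g::simple_lie_algebra affine \<Rightarrow> complex"
  where "level_character l X = l * snd X"

text \<open>Let \<open>L\<close> be a Lie algebra with bracket \<open>br\<close>. The space \<open>'l list \<Rightarrow>\<^sub>0 complex\<close> is the free
  associative algebra on the set \<open>L\<close>, a list being a word in elements of \<open>L\<close>. The enveloping
  algebra \<open>U(L)\<close> is its quotient by the span of \<open>enveloping_relations br\<close>, which is the two-sided
  ideal imposing linearity in the letters and \<open>xy - yx = [x,y]\<close>. For a subalgebra \<open>p\<close> with character
  \<open>\<eta>\<close>, the module \<open>U(L) \<otimes>\<^bsub>U(p)\<^esub> \<complex>\<^sub>\<eta>\<close> is the quotient of \<open>U(L) \<otimes> \<complex> = U(L)\<close> by the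
  span of the differences \<open>w x - \<eta>(x) w\<close> with \<open>w \<in> U(L)\<close> and \<open>x \<in> p\<close> (it suffices to take \<open>x\<close> in the
  generating set \<open>p\<close> of \<open>U(p)\<close>).\<close>

abbreviation word :: "'l list \<Rightarrow> ('l list \<Rightarrow>\<^sub>0 complex)"
  where "word w \<equiv> Poly_Mapping.single w 1"

definition enveloping_relations ::
    "('l::complex_vector \<Rightarrow> 'l \<Rightarrow> 'l) \<Rightarrow> ('l list \<Rightarrow>\<^sub>0 complex) set"
  where "enveloping_relations br =
      {word (v @ [x + y] @ w) - word (v @ [x] @ w) - word (v @ [y] @ w) | v w x y. True}
    \<union> {word (v @ [c *\<^sub>C x] @ w) - c *\<^sub>C word (v @ [x] @ w) | v w c x. True}
    \<union> {word (v @ [x, y] @ w) - word (v @ [y, x] @ w) - word (v @ [br x y] @ w) | v w x y. True}"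

definition induction_relations ::
    "'l::complex_vector set \<Rightarrow> ('l \<Rightarrow> complex) \<Rightarrow> ('l list \<Rightarrow>\<^sub>0 complex) set"
  where "induction_relations p \<eta> = {word (w @ [x]) - \<eta> x *\<^sub>C word w | w x. x \<in> p}"

definition apply_words ::
    "('l \<Rightarrow> 'v::complex_vector \<Rightarrow> 'v) \<Rightarrow> 'v \<Rightarrow> ('l list \<Rightarrow>\<^sub>0 complex) \<Rightarrow> 'v"
  where "apply_words act v f = 
    (\<Sum>w\<in>Poly_Mapping.keys f. Poly_Mapping.lookup f w *\<^sub>C foldr act w v)"

text \<open>\<open>is_induced_module br p \<eta> act vac\<close> says that the space \<open>'v\<close> with operators \<open>act x\<close>
  (\<open>x \<in> L\<close>) is the induced module \<open>U(L) \<otimes>\<^bsub>U(p)\<^esub> \<complex>\<^sub>\<eta>\<close>, with \<open>vac\<close> corresponding to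
  \<open>1 \<otimes> 1\<close>: the map \<open>x\<^sub>1\<dots>x\<^sub>r \<mapsto> x\<^sub>1\<cdots>x\<^sub>r vac\<close> is onto and its kernel is spanned by the
  relations above. This determines \<open>('v, act, vac)\<close> up to unique isomorphism, and it implies that
  \<open>act\<close> is a representation of \<open>L\<close>.\<close>

definition is_induced_module ::
    "('l::complex_vector \<Rightarrow> 'l \<Rightarrow> 'l) \<Rightarrow> 'l set \<Rightarrow> ('l \<Rightarrow> complex)
      \<Rightarrow> ('l \<Rightarrow> 'v::complex_vector \<Rightarrow> 'v) \<Rightarrow> 'v \<Rightarrow> bool"
  where "is_induced_module br p \<eta> act vac \<longleftrightarrow>
    (\<forall>x. clinear (act x)) \<and> surj (apply_words act vac)
    \<and> (\<forall>f. apply_words act vac f = 0 \<longleftrightarrow>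
          f \<in> cvec.span (enveloping_relations br \<union> induction_relations p \<eta>))"


section \<open>Vertex operator algebras and semi-conformal vectors\<close>

text \<open>A vertex operator map is given by its modes: \<open>Y v n w\<close> is \<open>v\<^sub>n w\<close>, where
  \<open>Y(v,z) = \<Sum>\<^sub>n v\<^sub>n z\<^sup>-\<^sup>n\<^sup>-\<^sup>1\<close>. The Jacobi identity is stated in its component form (Borcherds
  identity). By the truncation axiom only finitely many terms of each of its sums are nonzero, so
  \<^const>\<open>Sum_any\<close> is the sum over all \<open>i\<close>.\<close>

type_synonym 'v vertex_map = "'v \<Rightarrow> int \<Rightarrow> 'v \<Rightarrow> 'v"

definition vertex_algebra_on ::
    "'v::complex_vector set \<Rightarrow> 'v vertex_map \<Rightarrow> 'v \<Rightarrow> bool"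
  where "vertex_algebra_on U Y vac \<longleftrightarrow>
      cvec.subspace U \<and> vac \<in> U
    \<and> (\<forall>u\<in>U. \<forall>v\<in>U. \<forall>n. Y u n v \<in> U)
    \<and> (\<forall>u\<in>U. \<forall>v\<in>U. \<forall>w\<in>U. \<forall>n. Y (u + v) n w = Y u n w + Y v n w)
    \<and> (\<forall>u\<in>U. \<forall>v\<in>U. \<forall>w\<in>U. \<forall>n. Y u n (v + w) = Y u n v + Y u n w)
    \<and> (\<forall>c. \<forall>u\<in>U. \<forall>v\<in>U. \<forall>n. Y (c *\<^sub>C u) n v = c *\<^sub>C Y u n v)
    \<and> (\<forall>c. \<forall>u\<in>U. \<forall>v\<in>U. \<forall>n. Y u n (c *\<^sub>C v) = c *\<^sub>C Y u n v)
    \<and> (\<forall>u\<in>U. \<forall>v\<in>U. \<exists>N. \<forall>n\<ge>N. Y u n v = 0)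
    \<and> (\<forall>v\<in>U. \<forall>n. Y vac n v = (if n = - 1 then v else 0))
    \<and> (\<forall>v\<in>U. Y v (- 1) vac = v \<and> (\<forall>n\<ge>0. Y v n vac = 0))
    \<and> (\<forall>u\<in>U. \<forall>v\<in>U. \<forall>w\<in>U. \<forall>m n k.
          Sum_any (\<lambda>i::nat. ((of_int m :: complex) gchoose i) *\<^sub>C
              Y (Y u (n + int i) v) (m + k - int i) w)
        = Sum_any (\<lambda>i::nat. ((- 1) ^ i * ((of_int n :: complex) gchoose i)) *\<^sub>C
              (Y u (m + n - int i) (Y v (k + int i) w)
               - ((- 1) powi n) *\<^sub>C Y v (n + k - int i) (Y u (m + int i) w))))"

definition vertex_subalgebra ::
    "'v::complex_vector set \<Rightarrow> 'v vertex_map \<Rightarrow> 'v \<Rightarrow> bool"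
  where "vertex_subalgebra U Y vac \<longleftrightarrow>
    cvec.subspace U \<and> vac \<in> U \<and> (\<forall>u\<in>U. \<forall>v\<in>U. \<forall>n. Y u n v \<in> U)"

definition virasoro_mode :: "'v vertex_map \<Rightarrow> 'v \<Rightarrow> int \<Rightarrow> 'v \<Rightarrow> 'v"
  where "virasoro_mode Y \<omega> n = Y \<omega> (n + 1)"

definition weight_space ::
    "'v::complex_vector set \<Rightarrow> 'v vertex_map \<Rightarrow> 'v \<Rightarrow> int \<Rightarrow> 'v set"
  where "weight_space U Y \<omega> n = {v \<in> U. virasoro_mode Y \<omega> 0 v = of_int n *\<^sub>C v}"

text \<open>The sum of the weight spaces is automatically direct, as they are eigenspaces of \<open>L(0)\<close>
  for distinct eigenvalues.\<close>

definition vertex_operator_algebra_on ::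
    "'v::complex_vector set \<Rightarrow> 'v vertex_map \<Rightarrow> 'v \<Rightarrow> 'v \<Rightarrow> bool"
  where "vertex_operator_algebra_on U Y vac \<omega> \<longleftrightarrow>
      vertex_algebra_on U Y vac \<and> \<omega> \<in> U
    \<and> (\<exists>c. \<forall>m n. \<forall>v\<in>U.
          virasoro_mode Y \<omega> m (virasoro_mode Y \<omega> n v) - virasoro_mode Y \<omega> n (virasoro_mode Y \<omega> m v)
        = of_int (m - n) *\<^sub>C virasoro_mode Y \<omega> (m + n) v
          + (if m + n = 0 then (of_int (m ^ 3 - m) / 12 * c) *\<^sub>C v else 0))
    \<and> (\<forall>v\<in>U. \<forall>w\<in>U. \<forall>n. Y (virasoro_mode Y \<omega> (- 1) v) n w = - (of_int n *\<^sub>C Y v (n - 1) w))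
    \<and> U = cvec.span (\<Union>n. weight_space U Y \<omega> n)
    \<and> (\<forall>n. \<exists>B. finite B \<and> weight_space U Y \<omega> n \<subseteq> cvec.span B)
    \<and> (\<exists>N. \<forall>n<N. weight_space U Y \<omega> n = {0})"

definition semiconformal_vectors ::
    "'v::complex_vector vertex_map \<Rightarrow> 'v \<Rightarrow> 'v \<Rightarrow> 'v set"
  where "semiconformal_vectors Y vac \<omega> =
    {\<omega>'. \<exists>U. vertex_subalgebra U Y vac \<and> vertex_operator_algebra_on U Y vac \<omega>'
          \<and> (\<forall>n\<ge>0. \<forall>v\<in>U. Y \<omega>' n v = Y \<omega> n v)}"


section \<open>The universal affine vertex operator algebra\<close>

text \<open>\<open>is_universal_affine_voa l act vac Y\<close>: the space \<open>'v\<close> is the induced module of level \<open>l\<close>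
  with its canonical vertex algebra structure. The map \<open>Y\<close> is determined by the values
  \<open>Y(a(-1)vac, z)\<close>, because the vectors \<open>a(-1)vac\<close> generate the vertex algebra. That the conformal
  vector below turns it into a vertex operator algebra if \<open>l \<noteq> - h\<^sup>\<or>\<close> is a consequence and is not
  assumed.\<close>

definition is_universal_affine_voa ::
    "complex \<Rightarrow> ('g::simple_lie_algebra affine \<Rightarrow> 'v::complex_vector \<Rightarrow> 'v)
      \<Rightarrow> 'v \<Rightarrow> 'v vertex_map \<Rightarrow> bool"
  where "is_universal_affine_voa l act vac Y \<longleftrightarrow>
      is_induced_module affine_bracket affine_nonneg (level_character l) act vac
    \<and> vertex_algebra_on UNIV Y vac
    \<and> (\<forall>a n. Y (act (loop a (- 1)) vac) n = act (loop a n))"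

definition affine_conformal_vector ::
    "complex \<Rightarrow> ('g::simple_lie_algebra affine \<Rightarrow> 'v::complex_vector \<Rightarrow> 'v)
      \<Rightarrow> 'v \<Rightarrow> ('n::finite \<Rightarrow> 'g) \<Rightarrow> 'v"
  where "affine_conformal_vector l act vac u =
    (1 / (2 * (l + dual_coxeter_number TYPE('g)))) *\<^sub>C
      (\<Sum>i\<in>UNIV. act (loop (u i) (- 1)) (act (loop (u i) (- 1)) vac))"

definition quadratic_vector ::
    "('g::simple_lie_algebra affine \<Rightarrow> 'v::complex_vector \<Rightarrow> 'v)
      \<Rightarrow> 'v \<Rightarrow> ('n::finite \<Rightarrow> 'g) \<Rightarrow> complex^'n^'n \<Rightarrow> 'v"
  where "quadratic_vector act vac u A =
    (\<Sum>i\<in>UNIV. \<Sum>j\<in>UNIV.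
      (A $ i $ j) *\<^sub>C act (loop (u i) (- 1)) (act (loop (u j) (- 1)) vac))"

text \<open>The vectors \<open>a\<^sub>1(-n\<^sub>1)\<cdots>a\<^sub>r(-n\<^sub>r)vac\<close> with all \<open>n\<^sub>i \<ge> 1\<close> span the module, so their images
  determine the linear map \<open>S\<close>.\<close>

definition automorphism_action ::
    "('g::simple_lie_algebra affine \<Rightarrow> 'v::complex_vector \<Rightarrow> 'v)
      \<Rightarrow> 'v \<Rightarrow> ('g \<Rightarrow> 'g) \<Rightarrow> 'v \<Rightarrow> 'v"
  where "automorphism_action act vac \<sigma> =
    (THE S. clinear S \<and>
      (\<forall>ws :: ('g \<times> int) list. (\<forall>(a, n)\<in>set ws. n \<ge> 1) \<longrightarrow>
          S (foldr (\<lambda>(a, n). act (loop a (- n))) ws vac)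
        = foldr (\<lambda>(a, n). act (loop (\<sigma> a) (- n))) ws vac))"

end

theory Submission
  imports Defs
begin

text \<open>
  An automorphism \<open>\<sigma>\<close> of \<open>\<gg>\<close> preserves the Killing form, because \<open>ad (\<sigma> x)\<close> is conjugate to
  \<open>ad x\<close>, and therefore it extends to an automorphism of the affine Lie algebra that fixes \<open>K\<close>
  (lemma \<open>affine_map_bracket\<close>). By the universal property of induced modules
  (\<open>induced_module_lift\<close>) this extension lifts to a linear bijection \<open>S\<close> of the vacuum module with
  \<open>S vac = vac\<close> and \<open>S (a(n)v) = \<sigma>(a)(n) (S v)\<close>. Since the vectors \<open>a\<^sub>1(-n\<^sub>1)\<cdots>a\<^sub>r(-n\<^sub>r)vac\<close> span
  (\<open>creation_words_span\<close>), \<open>S\<close> is the only linear map with the prescribed values on them, that is,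
  it is the action of \<open>\<sigma>\<close>.

  The map \<open>S\<close> is an automorphism of the vertex algebra: it is compatible with the modes of the
  generators \<open>a(-1)vac\<close>, and the Borcherds identity expresses the modes of \<open>u\<^sub>n v\<close> through those of
  \<open>u\<close> and \<open>v\<close>, so compatibility spreads to all vectors
  (\<open>affine_module_automorphism_preserves_modes\<close>).

  Expanding \<open>\<sigma>(u\<^sub>j) = \<Sum>\<^sub>i g\<^sub>i\<^sub>j u\<^sub>i\<close> in \<open>S \<omega>\<^sub>A\<close> gives \<open>S \<omega>\<^sub>A = \<omega>\<^sub>B\<close> with \<open>B = g A g\<^sup>t\<^sup>r\<close>. As \<open>\<sigma>\<close> preserves the
  form and the basis is orthonormal, \<open>g g\<^sup>t\<^sup>r = 1\<close>. The conformal vector \<open>\<omega>\<close> is a multiple of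
  \<open>\<omega>\<^sub>A\<close> for \<open>A = 1\<close>, hence \<open>S \<omega> = \<omega>\<close>. Finally, an automorphism of the vertex algebra that fixes
  \<open>\<omega>\<close> maps a vertex subalgebra witnessing that a vector is semi-conformal to one witnessing the same
  for the image of this vector (\<open>semiconformal_vectors_image\<close>).
\<close>

section \<open>Linear maps between complex vector spaces\<close>

global_interpretation cvec_pair: vector_space_pair
  "scaleC :: complex \<Rightarrow> 'a \<Rightarrow> 'a::complex_vector" "scaleC :: complex \<Rightarrow> 'b \<Rightarrow> 'b::complex_vector" ..

lemma clinear_iff:
  "clinear f \<longleftrightarrow> (\<forall>x y. f (x + y) = f x + f y) \<and> (\<forall>c x. f (c *\<^sub>C x) = c *\<^sub>C f x)"
  by (simp add: Vector_Spaces.linear_iff cvec.vector_space_axioms)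

lemma clinear_compose: "clinear f \<Longrightarrow> clinear g \<Longrightarrow> clinear (\<lambda>x. g (f x))"
  by (simp add: clinear_iff)

lemma clinear_foldr: "(\<And>x. clinear (act x)) \<Longrightarrow> clinear (foldr act w)"
  by (induction w) (simp_all add: clinear_iff)

lemma clinear_inv:
  fixes f :: "'a::complex_vector \<Rightarrow> 'b::complex_vector"
  assumes f: "clinear f" and "bij f"
  shows "clinear (inv f)"
proof -
  have s: "f (inv f y) = y" for y
    using \<open>bij f\<close> by (simp add: bij_is_surj surj_f_inv_f)
  have "inv f (x + y) = inv f x + inv f y" for x y
    using f s by (intro inv_f_eq[OF bij_is_inj[OF \<open>bij f\<close>]]) (simp add: clinear_iff)
  moreover have "inv f (c *\<^sub>C x) = c *\<^sub>C inv f x" for c x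
    using f s by (intro inv_f_eq[OF bij_is_inj[OF \<open>bij f\<close>]]) (simp add: clinear_iff)
  ultimately show ?thesis by (simp add: clinear_iff)
qed

section \<open>Traces, the Killing form and automorphisms\<close>

text \<open>Both sides become the same double sum once each image \<open>f b\<close> is expanded through the other
  basis. This is what makes a trace defined by an arbitrary choice of basis invariant under
  conjugation.\<close>

lemma trace_basis_independent:
  fixes f :: "'a::complex_vector \<Rightarrow> 'a"
  assumes f: "clinear f"
    and B: "finite B" "cvec.independent B" "cvec.span B = UNIV"
    and C: "finite C" "cvec.independent C" "cvec.span C = UNIV"
  shows "(\<Sum>b\<in>B. cvec.representation B (f b) b) = (\<Sum>c\<in>C. cvec.representation C (f c) c)"
proof -
  have expand: "cvec.representation E (g v) e
      = (\<Sum>d\<in>D. cvec.representation D v d * cvec.representation E (g d) e)"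
    if "clinear g" and D: "finite D" "cvec.independent D" "cvec.span D = UNIV"
      and E: "cvec.independent E" "cvec.span E = UNIV" for g :: "'a \<Rightarrow> 'a" and D E v e
  proof -
    have "g v = g (\<Sum>d\<in>D. cvec.representation D v d *\<^sub>C d)"
      using D by (simp add: cvec.sum_representation_eq)
    also have "\<dots> = (\<Sum>d\<in>D. cvec.representation D v d *\<^sub>C g d)"
      using \<open>clinear g\<close> by (simp add: cvec_pair.linear_sum cvec_pair.linear_scale)
    finally show ?thesis
      using E by (simp add: cvec.representation_sum cvec.representation_scale)
  qed
  have id: "clinear (\<lambda>x::'a. x)" by (simp add: clinear_iff)
  have "(\<Sum>b\<in>B. cvec.representation B (f b) b)
      = (\<Sum>b\<in>B. \<Sum>c\<in>C. cvec.representation C (f b) c * cvec.representation B c b)"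
    by (intro sum.cong refl expand[OF id C B(2,3)])
  also have "\<dots> = (\<Sum>c\<in>C. \<Sum>b\<in>B. cvec.representation B c b * cvec.representation C (f b) c)"
    by (subst sum.swap) (simp add: mult.commute)
  also have "\<dots> = (\<Sum>c\<in>C. cvec.representation C (f c) c)"
    by (intro sum.cong refl expand[OF f B C(2,3), symmetric])
  finally show ?thesis .
qed

lemma representation_image:
  assumes \<sigma>: "clinear \<sigma>" "inj \<sigma>"
    and B: "finite B" "cvec.independent B" "cvec.span B = UNIV" and "b \<in> B"
  shows "cvec.representation (\<sigma> ` B) (\<sigma> v) (\<sigma> b) = cvec.representation B v b"
proof -
  let ?r = "cvec.representation B v"
  have ind: "cvec.independent (\<sigma> ` B)"
    using cvec_pair.linear_independent_injective_image[OF \<sigma>(1) B(2)] \<sigma>(2)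
    by (metis inj_on_subset subset_UNIV)
  have "\<sigma> v = \<sigma> (\<Sum>b\<in>B. ?r b *\<^sub>C b)"
    using B by (simp add: cvec.sum_representation_eq)
  also have "\<dots> = (\<Sum>b\<in>B. ?r b *\<^sub>C \<sigma> b)"
    using \<sigma>(1) by (simp add: cvec_pair.linear_sum cvec_pair.linear_scale)
  finally have "cvec.representation (\<sigma> ` B) (\<sigma> v) (\<sigma> b)
      = (\<Sum>b'\<in>B. ?r b' * cvec.representation (\<sigma> ` B) (\<sigma> b') (\<sigma> b))"
    using ind by (simp add: cvec.representation_sum cvec.representation_scale cvec.span_base cvec.span_scale)
  also have "\<dots> = (\<Sum>b'\<in>B. if b' = b then ?r b' else 0)"
    using ind \<sigma>(2) by (intro sum.cong) (auto simp: cvec.representation_basis inj_eq)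
  finally show ?thesis
    using B(1) \<open>b \<in> B\<close> by simp
qed

lemma finite_extend_basis:
  "finite (cvec.extend_basis {} :: 'g::simple_lie_algebra set)"
proof -
  obtain T :: "'g set" where T: "finite T" "\<And>x. \<exists>f. x = (\<Sum>b\<in>T. f b *\<^sub>C b)"
    using finite_dimensional by blast
  have "x \<in> cvec.span T" for x
    using T(2)[of x] by (auto intro: cvec.span_sum cvec.span_scale cvec.span_base)
  then show ?thesis
    using cvec.independent_span_bound[OF T(1) cvec.independent_extend_basis] cvec.independent_empty
    by blast
qed

text \<open>In the basis \<open>\<sigma> ` B\<close> the map \<open>f' = \<sigma> \<circ> f \<circ> \<sigma>\<^sup>-\<^sup>1\<close> has the same matrix as \<open>f\<close> in the basis \<open>B\<close>.\<close>

lemma ctrace_conjugate: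
  fixes f f' \<sigma> :: "'g::simple_lie_algebra \<Rightarrow> 'g"
  assumes f': "clinear f'" and \<sigma>: "clinear \<sigma>" "bij \<sigma>" and conj: "\<And>x. f' (\<sigma> x) = \<sigma> (f x)"
  shows "ctrace f' = ctrace f"
proof -
  define B where "B = (cvec.extend_basis {} :: 'g set)"
  have B: "finite B" "cvec.independent B" "cvec.span B = UNIV"
    unfolding B_def by (simp_all add: finite_extend_basis cvec.independent_extend_basis cvec.independent_empty)
  have inj: "inj \<sigma>" using \<sigma>(2) by (rule bij_is_inj)
  have C: "finite (\<sigma> ` B)" "cvec.independent (\<sigma> ` B)" "cvec.span (\<sigma> ` B) = UNIV"
    using B cvec_pair.linear_independent_injective_image[OF \<sigma>(1) B(2)] inj
      cvec_pair.linear_span_image[OF \<sigma>(1), of B] bij_is_surj[OF \<sigma>(2)]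
    by (auto intro: inj_on_subset)
  have "ctrace f' = (\<Sum>b\<in>B. cvec.representation B (f' b) b)"
    by (simp add: ctrace_def B_def Let_def)
  also have "\<dots> = (\<Sum>c\<in>\<sigma> ` B. cvec.representation (\<sigma> ` B) (f' c) c)"
    by (rule trace_basis_independent[OF f' B C])
  also have "\<dots> = (\<Sum>b\<in>B. cvec.representation (\<sigma> ` B) (\<sigma> (f b)) (\<sigma> b))"
    using inj by (subst sum.reindex) (auto intro: inj_on_subset simp: conj)
  also have "\<dots> = (\<Sum>b\<in>B. cvec.representation B (f b) b)"
    using representation_image[OF \<sigma>(1) inj B] by simp
  also have "\<dots> = ctrace f"
    by (simp add: ctrace_def B_def Let_def)
  finally show ?thesis .
qed

text \<open>Since \<open>ad (\<sigma> x) = \<sigma> \<circ> ad x \<circ> \<sigma>\<^sup>-\<^sup>1\<close>, the Killing form is a conjugation-invariant trace. The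
  normalizing factor is one and the same number on both sides.\<close>

lemma normalized_killing_form_automorphism:
  fixes \<sigma> :: "'g::simple_lie_algebra \<Rightarrow> 'g"
  assumes "lie_automorphism \<sigma>"
  shows "normalized_killing_form (\<sigma> x) (\<sigma> y) = normalized_killing_form x y"
proof -
  have "killing_form (\<sigma> x) (\<sigma> y) = killing_form x y"
    using assms unfolding killing_form_def lie_automorphism_def
    by (intro ctrace_conjugate[where \<sigma> = \<sigma>])
      (auto simp: clinear_iff lie_add_right lie_scaleC_right)
  then show ?thesis by (simp add: normalized_killing_form_def)
qed

lemma ctrace_linear:
  fixes f g :: "'g::simple_lie_algebra \<Rightarrow> 'g"
  shows "ctrace (\<lambda>x. f x + g x) = ctrace f + ctrace g" "ctrace (\<lambda>x. c *\<^sub>C f x) = c * ctrace f"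
proof -
  have B: "cvec.independent (cvec.extend_basis {} :: 'g set)"
    by (simp add: cvec.independent_extend_basis cvec.independent_empty)
  show "ctrace (\<lambda>x. f x + g x) = ctrace f + ctrace g" "ctrace (\<lambda>x. c *\<^sub>C f x) = c * ctrace f"
    unfolding ctrace_def Let_def
    by (simp_all add: B cvec.representation_add cvec.representation_scale sum.distrib
        cvec.independent_empty sum_distrib_left)
qed

lemma killing_form_bilinear:
  fixes x y z :: "'g::simple_lie_algebra"
  shows "killing_form (x + y) z = killing_form x z + killing_form y z"
    "killing_form x (y + z) = killing_form x y + killing_form x z"
    "killing_form (c *\<^sub>C x) y = c * killing_form x y"
    "killing_form x (c *\<^sub>C y) = c * killing_form x y"
  unfolding killing_form_def
  by (simp_all only: lie_add_left lie_add_right lie_scaleC_left lie_scaleC_right ctrace_linear)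

lemma clinear_normalized_killing_form:
  fixes x :: "'g::simple_lie_algebra"
  shows clinear_normalized_killing_form_left: "clinear (\<lambda>y. normalized_killing_form y x)"
    and clinear_normalized_killing_form_right: "clinear (normalized_killing_form x)"
  unfolding clinear_iff normalized_killing_form_def killing_form_bilinear scaleC_complex_def
  by (simp_all only: distrib_left mult.left_commute simp_thms)

text \<open>Invariance of the form gives \<open>g\<^sup>t\<^sup>r g = 1\<close> by comparing \<open>\<langle>\<sigma>(u\<^sub>i), \<sigma>(u\<^sub>j)\<rangle>\<close> with \<open>\<langle>u\<^sub>i, u\<^sub>j\<rangle>\<close>; for
  square matrices a left inverse is a right inverse.\<close>

lemma automorphism_matrix_orthogonal:
  fixes u :: "'n::finite \<Rightarrow> 'g::simple_lie_algebra" and g :: "complex^'n^'n"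
  assumes u: "orthonormal_basis u" and \<sigma>: "lie_automorphism \<sigma>"
    and g: "\<And>j. \<sigma> (u j) = (\<Sum>i\<in>UNIV. (g $ i $ j) *\<^sub>C u i)"
  shows "g ** transpose g = mat 1"
proof -
  have on: "normalized_killing_form (u i) (u j) = (if i = j then 1 else 0)" for i j
    using u by (simp add: orthonormal_basis_def)
  have "(\<Sum>k\<in>UNIV. g $ k $ i * g $ k $ j) = (if i = j then 1 else 0)" for i j
  proof -
    have "(if i = j then 1 else 0) = normalized_killing_form (\<sigma> (u i)) (\<sigma> (u j))"
      by (simp add: normalized_killing_form_automorphism[OF \<sigma>] on)
    also have "\<dots> = (\<Sum>m\<in>UNIV. g $ m $ j * (\<Sum>k\<in>UNIV. g $ k $ i * (if k = m then 1 else 0)))"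
      by (simp only: g cvec_pair.linear_sum[OF clinear_normalized_killing_form_left]
          cvec_pair.linear_sum[OF clinear_normalized_killing_form_right]
          cvec_pair.linear_scale[OF clinear_normalized_killing_form_left]
          cvec_pair.linear_scale[OF clinear_normalized_killing_form_right] on scaleC_complex_def)
    also have "\<dots> = (\<Sum>m\<in>UNIV. g $ m $ j * g $ m $ i)"
      by (simp add: if_distrib[of "(*) c" for c] cong: if_cong)
    finally show ?thesis by (simp add: mult.commute)
  qed
  then have "transpose g ** g = mat 1"
    by (simp add: matrix_matrix_mult_def transpose_def mat_def vec_eq_iff)
  then show ?thesis by (simp add: matrix_left_right_inverse)
qed

section \<open>The universal property of induced modules\<close>

lemma apply_words_superset:
  assumes "finite F" "Poly_Mapping.keys f \<subseteq> F"
  shows "apply_words act v f = (\<Sum>w\<in>F. Poly_Mapping.lookup f w *\<^sub>C foldr act w v)"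
  unfolding apply_words_def using assms
  by (intro sum.mono_neutral_left) (auto simp: in_keys_iff)

lemma clinear_apply_words: "clinear (apply_words act v)"
  unfolding clinear_iff
proof (intro conjI allI)
  fix f g :: "'a list \<Rightarrow>\<^sub>0 complex" and c :: complex
  let ?F = "Poly_Mapping.keys f \<union> Poly_Mapping.keys g"
  show "apply_words act v (f + g) = apply_words act v f + apply_words act v g"
    using apply_words_superset[of ?F f act v] apply_words_superset[of ?F g act v]
      apply_words_superset[of ?F "f + g" act v] keys_add[of f g]
    by (simp add: lookup_add scaleC_add_left sum.distrib)
  have "Poly_Mapping.keys (c *\<^sub>C f) \<subseteq> Poly_Mapping.keys f"
    by (auto simp: in_keys_iff lookup_scaleC scaleC_complex_def)
  then show "apply_words act v (c *\<^sub>C f) = c *\<^sub>C apply_words act v f"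
    using apply_words_superset[of "Poly_Mapping.keys f" f act v]
      apply_words_superset[of "Poly_Mapping.keys f" "c *\<^sub>C f" act v]
    by (simp add: lookup_scaleC scaleC_complex_def cvec.scale_sum_right scaleC_scaleC)
qed

lemma apply_words_word: "apply_words act v (word w) = foldr act w v"
  by (simp add: apply_words_def scaleC_one)

text \<open>Each generating relation evaluates at \<open>vac\<close> to one of the identities assumed of \<open>act\<close>, applied
  in the middle of a word or, for the induction relations, at its end. Linearity of the operators
  and of evaluation does the rest.\<close>

lemma apply_words_relations:
  assumes f: "f \<in> cvec.span (enveloping_relations br \<union> induction_relations p \<eta>)"
    and lin: "\<And>x. clinear (act x)"
    and add: "\<And>x y v. act (x + y) v = act x v + act y v"
    and scale: "\<And>c x v. act (c *\<^sub>C x) v = c *\<^sub>C act x v"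
    and bracket: "\<And>x y v. act (br x y) v = act x (act y v) - act y (act x v)"
    and vac: "\<And>x. x \<in> p \<Longrightarrow> act x vac = \<eta> x *\<^sub>C vac"
  shows "apply_words act vac f = 0"
proof (rule cvec_pair.linear_eq_0_on_span[OF clinear_apply_words _ f])
  fix f assume "f \<in> enveloping_relations br \<union> induction_relations p \<eta>"
  then show "apply_words act vac f = 0"
    by (auto simp: enveloping_relations_def induction_relations_def apply_words_word
        cvec_pair.linear_diff[OF clinear_apply_words] cvec_pair.linear_scale[OF clinear_apply_words]
        add scale bracket vac
        cvec_pair.linear_add[OF clinear_foldr[OF lin]] cvec_pair.linear_diff[OF clinear_foldr[OF lin]]
        cvec_pair.linear_scale[OF clinear_foldr[OF lin]])
qed

lemma induced_module_span:
  assumes "is_induced_module br p \<eta> act vac"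
  shows "v \<in> cvec.span (range (\<lambda>w. foldr act w vac))"
proof -
  obtain f where "v = apply_words act vac f"
    using assms unfolding is_induced_module_def by (metis surjD)
  then show ?thesis
    by (simp only: apply_words_def) (intro cvec.span_sum cvec.span_scale cvec.span_base rangeI)
qed

lemma induced_module_clinear: "is_induced_module br p \<eta> act vac \<Longrightarrow> clinear (act x)"
  unfolding is_induced_module_def by blast

lemma induced_module_linear_eqI:
  assumes "is_induced_module br p \<eta> act vac" "clinear S" "clinear T"
    and "\<And>w. S (foldr act w vac) = T (foldr act w vac)"
  shows "S = T"
proof
  show "S v = T v" for v
    by (rule cvec_pair.linear_eq_on_span[OF assms(2,3) _ induced_module_span[OF assms(1)]])
      (use assms(4) in auto)
qed

lemma induced_module_hom_eqI:
  assumes ind: "is_induced_module br p \<eta> act vac" and "clinear S" "clinear T"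
    and "S vac = T vac"
    and "\<And>x v. S (act x v) = act' x (S v)" "\<And>x v. T (act x v) = act' x (T v)"
  shows "S = T"
proof (rule induced_module_linear_eqI[OF ind \<open>clinear S\<close> \<open>clinear T\<close>])
  show "S (foldr act w vac) = T (foldr act w vac)" for w
    using assms by (induction w) simp_all
qed

text \<open>An induced module is a quotient by linear combinations of words, so nothing is known a priori
  about \<open>act\<close> as a function of the Lie algebra element. The relations supply each identity on the
  vectors \<open>x\<^sub>1\<cdots>x\<^sub>r vac\<close>, and these span.\<close>

lemma induced_module_representation:
  assumes ind: "is_induced_module br p \<eta> act vac"
  shows induced_module_add: "act (x + y) v = act x v + act y v"
    and induced_module_scaleC: "act (c *\<^sub>C x) v = c *\<^sub>C act x v"
    and induced_module_bracket: "act x (act y v) = act y (act x v) + act (br x y) v"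
    and induced_module_vacuum: "x \<in> p \<Longrightarrow> act x vac = \<eta> x *\<^sub>C vac"
proof -
  note lin_simps = apply_words_word cvec_pair.linear_diff[OF clinear_apply_words]
    cvec_pair.linear_add[OF clinear_apply_words] cvec_pair.linear_scale[OF clinear_apply_words]
  have lin: "\<And>x. clinear (act x)"
    and rel: "\<And>f. f \<in> enveloping_relations br \<union> induction_relations p \<eta> \<Longrightarrow> apply_words act vac f = 0"
    using ind cvec.span_base unfolding is_induced_module_def by blast+
  note lin' = lin[unfolded clinear_iff]
  \<comment> \<open>The relations with empty left context express each identity on the vectors \<open>w vac\<close>.\<close>
  have in_rel: "word ([] @ [x + y] @ w) - word ([] @ [x] @ w) - word ([] @ [y] @ w)
      \<in> enveloping_relations br" for w
    unfolding enveloping_relations_def by blast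
  have *: "act (x + y) (foldr act w vac) = act x (foldr act w vac) + act y (foldr act w vac)" for w
    using rel[OF UnI1[OF in_rel[of w]]] by (simp add: lin_simps algebra_simps)
  have "act (x + y) = (\<lambda>v. act x v + act y v)"
    by (rule induced_module_linear_eqI[OF ind lin _ *]) (use lin' in \<open>simp add: clinear_iff scaleC_add_right\<close>)
  then show "act (x + y) v = act x v + act y v" by simp
  have in_rel: "word ([] @ [c *\<^sub>C x] @ w) - c *\<^sub>C word ([] @ [x] @ w) \<in> enveloping_relations br" for w
    unfolding enveloping_relations_def by blast
  have *: "act (c *\<^sub>C x) (foldr act w vac) = c *\<^sub>C act x (foldr act w vac)" for w
    using rel[OF UnI1[OF in_rel[of w]]] by (simp add: lin_simps)
  have "act (c *\<^sub>C x) = (\<lambda>v. c *\<^sub>C act x v)"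
    by (rule induced_module_linear_eqI[OF ind lin _ *])
      (use lin' in \<open>simp add: clinear_iff scaleC_add_right scaleC_scaleC mult.commute\<close>)
  then show "act (c *\<^sub>C x) v = c *\<^sub>C act x v" by simp
  have in_rel: "word ([] @ [x, y] @ w) - word ([] @ [y, x] @ w) - word ([] @ [br x y] @ w)
      \<in> enveloping_relations br" for w
    unfolding enveloping_relations_def by blast
  have *: "act x (act y (foldr act w vac))
      = act y (act x (foldr act w vac)) + act (br x y) (foldr act w vac)" for w
    using rel[OF UnI1[OF in_rel[of w]]] by (simp add: lin_simps algebra_simps)
  have "(\<lambda>v. act x (act y v)) = (\<lambda>v. act y (act x v) + act (br x y) v)"
    by (rule induced_module_linear_eqI[OF ind])
      (use lin' * in \<open>simp_all add: clinear_iff scaleC_add_right\<close>)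
  then show "act x (act y v) = act y (act x v) + act (br x y) v" by (rule fun_cong)
  show "act x vac = \<eta> x *\<^sub>C vac" if "x \<in> p"
  proof -
    have in_rel: "word ([] @ [x]) - \<eta> x *\<^sub>C word [] \<in> induction_relations p \<eta>"
      unfolding induction_relations_def using that by blast
    then show ?thesis using rel[OF UnI2[OF in_rel]] by (simp add: lin_simps)
  qed
qed

text \<open>The universal property: evaluation of words in the target module factors through
  evaluation in the induced module, because the kernel of the latter is spanned by relations that
  hold in every target.\<close>

lemma induced_module_lift:
  assumes ind: "is_induced_module br p \<eta> act vac"
    and lin: "\<And>x. clinear (act' x)"
    and add: "\<And>x y v. act' (x + y) v = act' x v + act' y v"
    and scale: "\<And>c x v. act' (c *\<^sub>C x) v = c *\<^sub>C act' x v"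
    and bracket: "\<And>x y v. act' (br x y) v = act' x (act' y v) - act' y (act' x v)"
    and vac: "\<And>x. x \<in> p \<Longrightarrow> act' x vac' = \<eta> x *\<^sub>C vac'"
  obtains S where "clinear S" "S vac = vac'" "\<And>x v. S (act x v) = act' x (S v)"
proof -
  let ?ev = "apply_words act vac" and ?ev' = "apply_words act' vac'"
  \<comment> \<open>The choice of a preimage does not matter, since two preimages differ by relations.\<close>
  define S where "S = (\<lambda>v. ?ev' (SOME f. ?ev f = v))"
  have S_ev: "S (?ev f) = ?ev' f" for f
  proof -
    define f' where "f' = (SOME f'. ?ev f' = ?ev f)"
    have "?ev f' = ?ev f" unfolding f'_def by (rule someI) simp
    then have "?ev (f' - f) = 0"
      by (simp add: cvec_pair.linear_diff[OF clinear_apply_words])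
    then have "?ev' (f' - f) = 0"
      using ind lin add scale bracket vac unfolding is_induced_module_def
      by (intro apply_words_relations[where br = br and p = p and \<eta> = \<eta>]) auto
    then show ?thesis
      by (simp add: S_def f'_def cvec_pair.linear_diff[OF clinear_apply_words])
  qed
  have surj: "\<exists>f. v = ?ev f" for v
    using ind unfolding is_induced_module_def by (metis surjD)
  have S: "clinear S"
    unfolding clinear_iff
  proof (intro conjI allI)
    show "S (v + w) = S v + S w" for v w
      using surj[of v] surj[of w]
      by (auto simp: S_ev cvec_pair.linear_add[OF clinear_apply_words, symmetric])
    show "S (c *\<^sub>C v) = c *\<^sub>C S v" for c v
      using surj[of v]
      by (auto simp: S_ev cvec_pair.linear_scale[OF clinear_apply_words, symmetric])
  qed
  have S_word: "S (foldr act w vac) = foldr act' w vac'" for w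
    using S_ev[of "word w"] by (simp add: apply_words_word)
  have lin_act: "clinear (act x)" for x
    by (rule induced_module_clinear[OF ind])
  have "(\<lambda>v. S (act x v)) = (\<lambda>v. act' x (S v))" for x
    by (rule induced_module_linear_eqI[OF ind])
      (use S_word[of "x # w" for w] in \<open>simp_all add: S_word clinear_compose S lin lin_act\<close>)
  then have "S (act x v) = act' x (S v)" for x v by (rule fun_cong)
  then show ?thesis
    using that S S_word[of "[]"] by simp
qed

section \<open>Automorphisms of the affine Lie algebra\<close>

text \<open>The extension of \<open>\<sigma>\<close> to the affine Lie algebra that acts on coefficients and fixes \<open>t\<close> and \<open>K\<close>.\<close>

definition affine_map :: "('g::complex_lie_algebra \<Rightarrow> 'g) \<Rightarrow> 'g affine \<Rightarrow> 'g affine"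
  where "affine_map \<sigma> X = (Poly_Mapping.map \<sigma> (fst X), snd X)"

lemma lookup_affine_map:
  assumes "clinear \<sigma>"
  shows "Poly_Mapping.lookup (fst (affine_map \<sigma> X)) n = \<sigma> (Poly_Mapping.lookup (fst X) n)"
  by (simp add: affine_map_def map.rep_eq when_def cvec_pair.linear_0[OF assms])

lemma snd_affine_map: "snd (affine_map \<sigma> X) = snd X"
  by (simp add: affine_map_def)

lemma affine_eqI:
  fixes X Y :: "'g::complex_lie_algebra affine"
  assumes "\<And>n. Poly_Mapping.lookup (fst X) n = Poly_Mapping.lookup (fst Y) n" "snd X = snd Y"
  shows "X = Y"
  using assms by (simp add: prod_eq_iff poly_mapping_eqI)

lemma affine_map_loop:
  assumes "clinear \<sigma>"
  shows "affine_map \<sigma> (loop a n) = loop (\<sigma> a) n"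
  by (rule affine_eqI)
    (simp_all add: lookup_affine_map[OF assms] snd_affine_map loop_def lookup_single when_def
      cvec_pair.linear_0[OF assms])

lemma affine_map_add:
  assumes "clinear \<sigma>"
  shows "affine_map \<sigma> (X + Y) = affine_map \<sigma> X + affine_map \<sigma> Y"
  by (rule affine_eqI)
    (simp_all add: lookup_affine_map[OF assms] snd_affine_map lookup_add cvec_pair.linear_add[OF assms])

lemma affine_map_scaleC:
  assumes "clinear \<sigma>"
  shows "affine_map \<sigma> (c *\<^sub>C X) = c *\<^sub>C affine_map \<sigma> X"
  by (rule affine_eqI)
    (simp_all add: lookup_affine_map[OF assms] snd_affine_map scaleC_prod_def lookup_scaleC
      cvec_pair.linear_scale[OF assms])

lemma affine_map_inverse:
  assumes "clinear \<sigma>" "clinear \<tau>" "\<And>x. \<sigma> (\<tau> x) = x"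
  shows "affine_map \<sigma> (affine_map \<tau> X) = X"
  by (rule affine_eqI) (simp_all add: lookup_affine_map assms snd_affine_map)

lemma keys_affine_map:
  assumes "clinear \<sigma>" "inj \<sigma>"
  shows "Poly_Mapping.keys (fst (affine_map \<sigma> X)) = Poly_Mapping.keys (fst X)"
proof -
  have "\<sigma> x = 0 \<longleftrightarrow> x = 0" for x
    using injD[OF assms(2), of x 0] cvec_pair.linear_0[OF assms(1)] by auto
  then show ?thesis
    by (intro set_eqI) (simp only: in_keys_iff lookup_affine_map[OF assms(1)])
qed

text \<open>The central term of the bracket is preserved because \<open>\<sigma>\<close> preserves the normalized Killing
  form.\<close>

lemma affine_map_bracket:
  fixes \<sigma> :: "'g::simple_lie_algebra \<Rightarrow> 'g"
  assumes "lie_automorphism \<sigma>"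
  shows "affine_map \<sigma> (affine_bracket X Y) = affine_bracket (affine_map \<sigma> X) (affine_map \<sigma> Y)"
proof -
  have \<sigma>: "clinear \<sigma>" "inj \<sigma>" "\<And>x y. \<sigma> (lie x y) = lie (\<sigma> x) (\<sigma> y)"
    using assms by (auto simp: lie_automorphism_def bij_is_inj)
  note keys = keys_affine_map[OF \<sigma>(1,2)]
  note lookup = lookup_affine_map[OF \<sigma>(1)]
  have single: "\<sigma> (Poly_Mapping.lookup (Poly_Mapping.single n x) k)
      = Poly_Mapping.lookup (Poly_Mapping.single n (\<sigma> x)) k" for n x and k :: int
    by (simp add: lookup_single when_def cvec_pair.linear_0[OF \<sigma>(1)])
  show ?thesis
    by (rule affine_eqI)
      (simp_all add: affine_bracket_def keys lookup snd_affine_map lookup_sum single \<sigma>(3)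
        cvec_pair.linear_sum[OF \<sigma>(1)] normalized_killing_form_automorphism[OF assms])
qed

lemma lie_automorphism_inv:
  assumes "lie_automorphism \<sigma>"
  shows "lie_automorphism (inv \<sigma>)"
proof -
  have \<sigma>: "clinear \<sigma>" "bij \<sigma>" "\<And>x y. \<sigma> (lie x y) = lie (\<sigma> x) (\<sigma> y)"
    using assms by (auto simp: lie_automorphism_def)
  have "inv \<sigma> (lie x y) = lie (inv \<sigma> x) (inv \<sigma> y)" for x y
    using \<sigma>(2,3) by (intro inv_f_eq[OF bij_is_inj[OF \<sigma>(2)]]) (simp add: bij_is_surj surj_f_inv_f)
  then show ?thesis
    by (simp add: lie_automorphism_def clinear_inv \<sigma>(1,2) bij_imp_bij_inv)
qed

text \<open>Twisting the action by \<open>affine_map \<sigma>\<close> gives a module in which \<open>vac\<close> still satisfies the defining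
  conditions of the level \<open>l\<close> vacuum, so the universal property applies to it.\<close>

lemma affine_module_lift:
  fixes act :: "'g::simple_lie_algebra affine \<Rightarrow> 'v::complex_vector \<Rightarrow> 'v"
  assumes ind: "is_induced_module affine_bracket affine_nonneg (level_character l) act vac"
    and \<sigma>: "lie_automorphism \<sigma>"
  obtains S where "clinear S" "S vac = vac" "\<And>X v. S (act X v) = act (affine_map \<sigma> X) (S v)"
proof -
  have lin: "clinear \<sigma>" and inj: "inj \<sigma>"
    using \<sigma> by (auto simp: lie_automorphism_def bij_is_inj)
  show ?thesis
  proof (rule induced_module_lift[OF ind, where act' = "\<lambda>X. act (affine_map \<sigma> X)" and vac' = vac])
    show "clinear (act (affine_map \<sigma> X))" for X
      by (rule induced_module_clinear[OF ind])
    show "act (affine_map \<sigma> X) vac = level_character l X *\<^sub>C vac" if "X \<in> affine_nonneg" for X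
    proof -
      have "affine_map \<sigma> X \<in> affine_nonneg"
        using that by (simp add: affine_nonneg_def keys_affine_map[OF lin inj])
      from induced_module_vacuum[OF ind this] show ?thesis
        by (simp add: level_character_def affine_map_def)
    qed
    show "act (affine_map \<sigma> (affine_bracket X Y)) v
        = act (affine_map \<sigma> X) (act (affine_map \<sigma> Y) v) - act (affine_map \<sigma> Y) (act (affine_map \<sigma> X) v)"
      for X Y v
      unfolding affine_map_bracket[OF \<sigma>]
        induced_module_bracket[OF ind, of "affine_map \<sigma> X" "affine_map \<sigma> Y"] by simp
  qed (simp_all only: affine_map_add[OF lin] affine_map_scaleC[OF lin]
      induced_module_add[OF ind] induced_module_scaleC[OF ind] that)
qed

text \<open>The lifts of \<open>\<sigma>\<close> and of \<open>\<sigma>\<^sup>-\<^sup>1\<close> are mutually inverse: both composites fix \<open>vac\<close> and commute with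
  the action, and the identity is the only linear map that does so.\<close>

lemma affine_module_automorphism:
  fixes act :: "'g::simple_lie_algebra affine \<Rightarrow> 'v::complex_vector \<Rightarrow> 'v"
  assumes ind: "is_induced_module affine_bracket affine_nonneg (level_character l) act vac"
    and \<sigma>: "lie_automorphism \<sigma>"
  obtains S where "clinear S" "bij S" "S vac = vac" "\<And>X v. S (act X v) = act (affine_map \<sigma> X) (S v)"
proof -
  obtain S where S: "clinear S" "S vac = vac" "\<And>X v. S (act X v) = act (affine_map \<sigma> X) (S v)"
    using affine_module_lift[OF ind \<sigma>] by blast
  obtain T where T: "clinear T" "T vac = vac" "\<And>X v. T (act X v) = act (affine_map (inv \<sigma>) X) (T v)"
    using affine_module_lift[OF ind lie_automorphism_inv[OF \<sigma>]] by blast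
  have bij: "bij \<sigma>" and lin: "clinear \<sigma>"
    using \<sigma> by (auto simp: lie_automorphism_def)
  have "affine_map (inv \<sigma>) (affine_map \<sigma> X) = X" "affine_map \<sigma> (affine_map (inv \<sigma>) X) = X" for X
    using bij by (simp_all add: affine_map_inverse lin clinear_inv bij_is_inj bij_is_surj surj_f_inv_f)
  note inverse = this
  have id: "clinear (\<lambda>v::'v. v)" by (simp add: clinear_iff)
  have "(\<lambda>v. T (S v)) = (\<lambda>v. v)"
    by (rule induced_module_hom_eqI[OF ind clinear_compose[OF S(1) T(1)] id, where act' = act])
      (simp_all only: S(2,3) T(2,3) inverse)
  moreover have "(\<lambda>v. S (T v)) = (\<lambda>v. v)"
    by (rule induced_module_hom_eqI[OF ind clinear_compose[OF T(1) S(1)] id, where act' = act])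
      (simp_all only: S(2,3) T(2,3) inverse)
  ultimately have "bij S"
    by (intro o_bij[of T]) (simp_all add: comp_def id_def)
  then show ?thesis using that S by blast
qed

section \<open>Creation words span the vacuum module\<close>

definition creation_word ::
    "('g::complex_lie_algebra affine \<Rightarrow> 'v \<Rightarrow> 'v) \<Rightarrow> ('g \<times> int) list \<Rightarrow> 'v \<Rightarrow> 'v"
  where "creation_word act ws = foldr (\<lambda>(a, n). act (loop a (- n))) ws"

lemma affine_bracket_loop:
  "affine_bracket (loop a n) (loop b m)
    = loop (lie a b) (n + m) + (0, if n + m = 0 then of_int n * normalized_killing_form a b else 0)"
proof -
  have 0: "lie x 0 = 0" "lie 0 x = 0" for x :: 'a
    using lie_scaleC_right[of x 0 0] lie_scaleC_left[of 0 0 x] by simp_all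
  have k0: "normalized_killing_form x 0 = 0" "normalized_killing_form 0 x = 0" for x :: 'a
    using cvec_pair.linear_0[OF clinear_normalized_killing_form_left]
      cvec_pair.linear_0[OF clinear_normalized_killing_form_right] by auto
  have "m = - n" if "n + m = 0" using that by simp
  then show ?thesis
    by (auto simp: affine_bracket_def loop_def 0 k0 lookup_single when_def)
qed

lemma affine_bracket_central:
  "affine_bracket (0, c) X = 0"
  by (simp add: affine_bracket_def zero_prod_def)

lemma affine_decompose:
  "X = (\<Sum>n\<in>Poly_Mapping.keys (fst X). loop (Poly_Mapping.lookup (fst X) n) n) + (0, snd X)"
proof (rule prod_eqI)
  let ?s = "\<Sum>n\<in>Poly_Mapping.keys (fst X). loop (Poly_Mapping.lookup (fst X) n) n"
  have "Poly_Mapping.lookup (fst ?s) k = Poly_Mapping.lookup (fst X) k" for k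
  proof -
    have "fst ?s = (\<Sum>n\<in>Poly_Mapping.keys (fst X). Poly_Mapping.single n (Poly_Mapping.lookup (fst X) n))"
      by (simp add: fst_sum loop_def)
    then show ?thesis
      by (simp add: lookup_sum lookup_single when_def in_keys_iff)
  qed
  then show "fst X = fst (?s + (0, snd X))"
    by (auto intro: poly_mapping_eqI)
  show "snd X = snd (?s + (0, snd X))"
    by (simp add: snd_sum loop_def)
qed

text \<open>The easy half of the Poincare-Birkhoff-Witt theorem. The span of the creation words is stable
  under every \<open>a(n)\<close>: for \<open>n < 0\<close> this is clear, and for \<open>n \<ge> 0\<close> one moves \<open>a(n)\<close> to the right past
  \<open>b(-m)\<close> until it reaches the vacuum and kills it. Each commutator leaves a scalar and a term
  \<open>[a,b](n - m)\<close> acting on a shorter word, which is why the induction on the word is over all \<open>a\<close>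
  and \<open>n\<close> simultaneously. As the span contains \<open>vac\<close> and is stable under the whole affine Lie
  algebra, it is everything.\<close>

lemma creation_words_span:
  fixes act :: "'g::simple_lie_algebra affine \<Rightarrow> 'v::complex_vector \<Rightarrow> 'v"
  assumes ind: "is_induced_module affine_bracket affine_nonneg (level_character l) act vac"
  shows "v \<in> cvec.span {creation_word act ws vac | ws. \<forall>(a, n)\<in>set ws. n \<ge> 1}"
proof -
  let ?C = "cvec.span {creation_word act ws vac | ws. \<forall>(a, n)\<in>set ws. n \<ge> 1}"
  have lin: "clinear (act X)" for X
    by (rule induced_module_clinear[OF ind])
  have closed_span: "act X v \<in> ?C"
    if "v \<in> ?C" "\<And>ws. (\<forall>(a, n)\<in>set ws. n \<ge> 1) \<Longrightarrow> act X (creation_word act ws vac) \<in> ?C" for X v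
  proof -
    have "?C \<subseteq> act X -` ?C"
      using that(2)
      by (intro cvec.span_minimal cvec_pair.linear_subspace_vimage[OF lin cvec.subspace_span]) blast
    then show ?thesis using that(1) by blast
  qed
  have word_in: "creation_word act ws vac \<in> ?C" if "\<forall>(a, n)\<in>set ws. n \<ge> 1" for ws
    using that by (blast intro: cvec.span_base)
  have neg: "act (loop a (- n)) v \<in> ?C" if "v \<in> ?C" "n \<ge> 1" for a n v
  proof (rule closed_span[OF that(1)])
    fix ws :: "('g \<times> int) list" assume "\<forall>(a, n)\<in>set ws. n \<ge> 1"
    then show "act (loop a (- n)) (creation_word act ws vac) \<in> ?C"
      using word_in[of "(a, n) # ws"] \<open>n \<ge> 1\<close> by (simp add: creation_word_def)
  qed
  have central: "act (0, c) (creation_word act ws vac) = (l * c) *\<^sub>C creation_word act ws vac" for c ws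
  proof (induction ws)
    case Nil
    then show ?case
      using induced_module_vacuum[OF ind, of "(0, c)"]
      by (simp add: creation_word_def affine_nonneg_def level_character_def)
  next
    case (Cons x ws)
    obtain a n where [simp]: "x = (a, n)" by fastforce
    have 0: "act 0 v = 0" for v using induced_module_scaleC[OF ind, of 0 0] by simp
    have "act (0, c) (act (loop a (- n)) (creation_word act ws vac))
        = act (loop a (- n)) (act (0, c) (creation_word act ws vac))"
      by (subst induced_module_bracket[OF ind]) (simp add: affine_bracket_central 0)
    then show ?case
      using Cons by (simp add: creation_word_def cvec_pair.linear_scale[OF lin])
  qed
  have nonneg: "act (loop a n) (creation_word act ws vac) \<in> ?C"
    if "n \<ge> 0" "\<forall>(a, n)\<in>set ws. n \<ge> 1" for a n ws
    using that
  proof (induction ws arbitrary: a n)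
    case Nil
    then have "loop a n \<in> affine_nonneg"
      by (auto simp: affine_nonneg_def loop_def)
    from induced_module_vacuum[OF ind this] show ?case
      by (simp add: creation_word_def level_character_def loop_def cvec.span_zero)
  next
    case (Cons x ws)
    obtain b m where x [simp]: "x = (b, m)" by fastforce
    let ?v = "creation_word act ws vac"
    have m: "m \<ge> 1" and ws: "\<forall>(a, n)\<in>set ws. n \<ge> 1" using Cons.prems by auto
    have "act (loop (lie a b) (n - m)) ?v \<in> ?C"
    proof (cases "n - m \<ge> 0")
      case True
      then show ?thesis using Cons.IH ws by blast
    next
      case False
      then show ?thesis using neg[OF word_in[OF ws], of "m - n"] by simp
    qed
    moreover have "act (loop b (- m)) (act (loop a n) ?v) \<in> ?C"
      using neg m Cons.IH Cons.prems(1) ws by blast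
    moreover have "act (0, c) ?v \<in> ?C" for c
      using central word_in[OF ws] by (simp add: cvec.span_scale)
    moreover have "act (loop a n) (creation_word act (x # ws) vac)
        = act (loop b (- m)) (act (loop a n) ?v) + act (affine_bracket (loop a n) (loop b (- m))) ?v"
      by (simp add: creation_word_def) (rule induced_module_bracket[OF ind])
    ultimately show ?case
      by (simp add: affine_bracket_loop induced_module_add[OF ind] cvec.span_add)
  qed
  have loop: "act (loop a n) v \<in> ?C" if "v \<in> ?C" for a n v
  proof (cases "n \<ge> 0")
    case True
    then show ?thesis using closed_span[OF that] nonneg by blast
  next
    case False
    then show ?thesis using neg[OF that, of "- n" a] by simp
  qed
  have act: "act X v \<in> ?C" if "v \<in> ?C" for X v
  proof -
    have "clinear (\<lambda>X. act X v)"
      by (simp add: clinear_iff induced_module_add[OF ind] induced_module_scaleC[OF ind])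
    note * = cvec_pair.linear_sum[OF this]
    have "act (0, snd X) v \<in> ?C"
      using closed_span[OF that, of "(0, snd X)"] central word_in by (simp add: cvec.span_scale)
    then show ?thesis
      by (subst affine_decompose) (auto simp: induced_module_add[OF ind] * intro!: cvec.span_add cvec.span_sum loop that)
  qed
  have "vac \<in> ?C"
    using word_in[of "[]"] by (simp add: creation_word_def)
  then have "foldr act w vac \<in> ?C" for w
    by (induction w) (simp_all only: foldr.simps comp_apply id_apply act)
  then show ?thesis
    by (intro subsetD[OF cvec.span_minimal[OF _ cvec.subspace_span] induced_module_span[OF ind]])
      (auto simp only:)
qed

text \<open>The description of \<^const>\<open>automorphism_action\<close> prescribes only the images of the creation
  words. They span, so any linear map with these values is the described one.\<close>

lemma automorphism_action_eqI:
  fixes act :: "'g::simple_lie_algebra affine \<Rightarrow> 'v::complex_vector \<Rightarrow> 'v"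
  assumes ind: "is_induced_module affine_bracket affine_nonneg (level_character l) act vac"
    and \<sigma>: "clinear \<sigma>"
    and S: "clinear S" "S vac = vac" "\<And>X v. S (act X v) = act (affine_map \<sigma> X) (S v)"
  shows "automorphism_action act vac \<sigma> = S"
proof -
  have S_word: "S (creation_word act ws vac) = foldr (\<lambda>(a, n). act (loop (\<sigma> a) (- n))) ws vac" for ws
    by (induction ws) (auto simp: creation_word_def S affine_map_loop[OF \<sigma>])
  show ?thesis
    unfolding automorphism_action_def creation_word_def[symmetric]
  proof (rule the_equality)
    fix T
    assume T: "clinear T \<and> (\<forall>ws. (\<forall>(a, n)\<in>set ws. n \<ge> 1) \<longrightarrow>
        T (creation_word act ws vac) = foldr (\<lambda>(a, n). act (loop (\<sigma> a) (- n))) ws vac)"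
    show "T = S"
    proof
      show "T v = S v" for v
        by (rule cvec_pair.linear_eq_on_span[OF _ S(1) _ creation_words_span[OF ind]])
          (use T in \<open>auto simp: S_word\<close>)
    qed
  qed (auto simp: S_word S(1))
qed

section \<open>Automorphisms of vertex algebras\<close>

text \<open>Injectivity makes both sums have the same support, so the identity also holds when the support is
  infinite and both sums are \<open>0\<close> by convention.\<close>

lemma clinear_Sum_any:
  assumes S: "clinear S" and "inj S"
  shows "S (Sum_any f) = Sum_any (\<lambda>i. S (f i))"
proof -
  have "S x = 0 \<longleftrightarrow> x = 0" for x
    using injD[OF \<open>inj S\<close>, of x 0] cvec_pair.linear_0[OF S] by auto
  then show ?thesis
    by (simp add: Sum_any.expand_set cvec_pair.linear_sum[OF S])
qed

text \<open>The case \<open>m = 0\<close> of the Borcherds identity, whose left-hand side reduces to its first term. It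
  expresses the modes of \<open>u\<^sub>n v\<close> through those of \<open>u\<close> and \<open>v\<close>.\<close>

lemma vertex_algebra_iterate:
  assumes "vertex_algebra_on UNIV Y vac"
  shows "Y (Y u n v) k w = Sum_any (\<lambda>i::nat. ((- 1) ^ i * ((of_int n :: complex) gchoose i)) *\<^sub>C
              (Y u (n - int i) (Y v (k + int i) w)
               - ((- 1) powi n) *\<^sub>C Y v (n + k - int i) (Y u (int i) w)))"
proof -
  let ?f = "\<lambda>i::nat. ((of_int 0 :: complex) gchoose i) *\<^sub>C Y (Y u (n + int i) v) (0 + k - int i) w"
  have "Sum_any ?f = (\<Sum>i\<in>{0}. ?f i)"
  proof (rule Sum_any.expand_superset)
    have "?f i = 0" if "i \<noteq> 0" for i
      using that by (cases i) simp_all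
    then show "{i. ?f i \<noteq> 0} \<subseteq> {0}" by blast
  qed simp
  then have "Y (Y u n v) k w = Sum_any ?f"
    by (simp add: scaleC_one)
  also have "\<dots> = Sum_any (\<lambda>i::nat. ((- 1) ^ i * ((of_int n :: complex) gchoose i)) *\<^sub>C
              (Y u (0 + n - int i) (Y v (k + int i) w)
               - ((- 1) powi n) *\<^sub>C Y v (n + k - int i) (Y u (0 + int i) w)))"
    using assms unfolding vertex_algebra_on_def by blast
  finally show ?thesis by simp
qed

definition preserves_modes ::
    "('v \<Rightarrow> 'v) \<Rightarrow> 'v vertex_map \<Rightarrow> 'v \<Rightarrow> bool"
  where "preserves_modes S Y u \<longleftrightarrow> (\<forall>n v. S (Y u n v) = Y (S u) n (S v))"

text \<open>By the iterate formula, compatibility with all modes of \<open>u\<close> and of \<open>v\<close> passes to \<open>u\<^sub>n v\<close>. Hence it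
  has to be checked on generators only.\<close>

lemma preserves_modes_iterate:
  assumes Y: "vertex_algebra_on UNIV Y vac" and S: "clinear S" "inj S"
    and u: "preserves_modes S Y u" and v: "preserves_modes S Y v"
  shows "preserves_modes S Y (Y u n v)"
  unfolding preserves_modes_def
proof (intro allI)
  fix k w
  have hom: "S (Y u n' w') = Y (S u) n' (S w')" "S (Y v n' w') = Y (S v) n' (S w')" for n' w'
    using u v by (simp_all add: preserves_modes_def)
  show "S (Y (Y u n v) k w) = Y (S (Y u n v)) k (S w)"
    unfolding hom vertex_algebra_iterate[OF Y, where n = n]
    by (simp add: clinear_Sum_any[OF S] cvec_pair.linear_scale[OF S(1)] cvec_pair.linear_diff[OF S(1)] hom)
qed

lemma subspace_preserves_modes:
  assumes Y: "vertex_algebra_on UNIV Y vac" and S: "clinear S"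
  shows "cvec.subspace {u. preserves_modes S Y u}"
proof -
  have "\<forall>u v w n. Y (u + v) n w = Y u n w + Y v n w"
    and "\<forall>c u w n. Y (c *\<^sub>C u) n w = c *\<^sub>C Y u n w"
    using Y unfolding vertex_algebra_on_def ball_UNIV by - (elim conjE, assumption)+
  then have add: "Y (u + v) n w = Y u n w + Y v n w" and scale: "Y (c *\<^sub>C u) n w = c *\<^sub>C Y u n w"
    for u v w n c by simp_all
  have zero: "Y 0 n w = 0" for n w using scale[of 0 0] by simp
  show ?thesis
    by (simp add: cvec.subspace_def preserves_modes_def add scale zero
        cvec_pair.linear_0[OF S] cvec_pair.linear_add[OF S] cvec_pair.linear_scale[OF S])
qed

text \<open>On a generator \<open>a(-1)vac\<close> the modes are the operators \<open>a(n)\<close>, where compatibility is the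
  intertwining property of \<open>S\<close>. A creation word \<open>a(-n)w\<close> is the iterate \<open>(a(-1)vac)\<^sub>-\<^sub>n w\<close>, so
  compatibility spreads to all creation words and, by linearity in \<open>u\<close>, to their span.\<close>

lemma affine_module_automorphism_preserves_modes:
  fixes act :: "'g::simple_lie_algebra affine \<Rightarrow> 'v::complex_vector \<Rightarrow> 'v"
  assumes voa: "is_universal_affine_voa l act vac Y" and \<sigma>: "clinear \<sigma>"
    and S: "clinear S" "inj S" "S vac = vac" "\<And>X v. S (act X v) = act (affine_map \<sigma> X) (S v)"
  shows "preserves_modes S Y u"
proof -
  have ind: "is_induced_module affine_bracket affine_nonneg (level_character l) act vac"
    and Y: "vertex_algebra_on UNIV Y vac"
    and fields: "\<And>a n. Y (act (loop a (- 1)) vac) n = act (loop a n)"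
    using voa by (auto simp: is_universal_affine_voa_def)
  have vac: "preserves_modes S Y vac"
  proof -
    have "Y vac n v = (if n = - 1 then v else 0)" for n v
      using Y unfolding vertex_algebra_on_def by blast
    then show ?thesis
      by (simp add: preserves_modes_def S(3) cvec_pair.linear_0[OF S(1)])
  qed
  have gen: "preserves_modes S Y (act (loop a (- 1)) vac)" for a
    by (simp add: preserves_modes_def S(3,4) affine_map_loop[OF \<sigma>] fields)
  have word: "preserves_modes S Y (creation_word act ws vac)" for ws
  proof (induction ws)
    case Nil
    show ?case by (simp add: creation_word_def vac)
  next
    case (Cons x ws)
    obtain a n where x: "x = (a, n)" by fastforce
    show ?case
      using preserves_modes_iterate[OF Y S(1,2) gen Cons.IH, of a "- n"]
      by (simp add: creation_word_def x fields)
  qed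
  have "cvec.span {creation_word act ws vac | ws. \<forall>(a, n)\<in>set ws. n \<ge> 1} \<subseteq> {u. preserves_modes S Y u}"
    by (intro cvec.span_minimal subspace_preserves_modes[OF Y S(1)]) (use word in blast)
  then show ?thesis
    using creation_words_span[OF ind, of u] by blast
qed

text \<open>Apart from the closure conditions, every axiom is universally quantified over the vectors and restricts to a
  subset. This spares transporting the axioms along a map: the image of a vertex subalgebra is again
  a vertex subalgebra, hence a vertex algebra.\<close>

lemma vertex_subalgebra_vertex_algebra:
  assumes Y: "vertex_algebra_on UNIV Y vac" and U: "vertex_subalgebra U Y vac"
  shows "vertex_algebra_on U Y vac"
proof -
  \<comment> \<open>The axioms on the whole space, separated and stripped of their outer quantifiers.\<close>
  note Y3 = Y[unfolded vertex_algebra_on_def ball_UNIV, THEN conjunct2, THEN conjunct2, THEN conjunct2]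
  note Y5 = Y3[THEN conjunct2, THEN conjunct2]
  note Y7 = Y5[THEN conjunct2, THEN conjunct2]
  note Y9 = Y7[THEN conjunct2, THEN conjunct2]
  note axioms = Y3[THEN conjunct1, rule_format] Y3[THEN conjunct2, THEN conjunct1, rule_format]
    Y5[THEN conjunct1, rule_format] Y5[THEN conjunct2, THEN conjunct1, rule_format]
    Y7[THEN conjunct1, rule_format] Y7[THEN conjunct2, THEN conjunct1, rule_format]
    Y9[THEN conjunct1, THEN spec, THEN conjunct1]
    Y9[THEN conjunct1, THEN spec, THEN conjunct2, rule_format]
    Y9[THEN conjunct2, rule_format]
  show ?thesis
    using U unfolding vertex_algebra_on_def vertex_subalgebra_def
    by (elim conjE, intro conjI) (assumption | rule conjI ballI allI impI | (rule axioms; assumption))+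
qed

lemma vertex_subalgebra_image:
  assumes S: "clinear S" "S vac = vac" "\<And>u. preserves_modes S Y u"
    and U: "vertex_subalgebra U Y vac"
  shows "vertex_subalgebra (S ` U) Y vac"
proof -
  have "Y (S u) n (S v) = S (Y u n v)" for u n v
    using S(3) by (simp add: preserves_modes_def)
  moreover have "vac \<in> S ` U"
    using U S(2) unfolding vertex_subalgebra_def by (metis imageI)
  ultimately show ?thesis
    using U cvec_pair.linear_subspace_image[OF S(1)] by (auto simp: vertex_subalgebra_def)
qed

lemma vertex_operator_algebra_image:
  assumes Y: "vertex_algebra_on UNIV Y vac"
    and S: "clinear S" "inj S" "S vac = vac" "\<And>u. preserves_modes S Y u"
    and sub: "vertex_subalgebra U Y vac" and U: "vertex_operator_algebra_on U Y vac \<omega>"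
  shows "vertex_operator_algebra_on (S ` U) Y vac (S \<omega>)"
proof -
  have hom: "Y (S u) n (S v) = S (Y u n v)" for u n v
    using S(4) by (simp add: preserves_modes_def)
  have mode: "virasoro_mode Y (S \<omega>) n (S v) = S (virasoro_mode Y \<omega> n v)" for n v
    by (simp add: virasoro_mode_def hom)
  have inj: "S x = S y \<longleftrightarrow> x = y" for x y
    using S(2) by (simp add: inj_eq)
  note lin = cvec_pair.linear_0[OF S(1)] cvec_pair.linear_add[OF S(1), symmetric]
    cvec_pair.linear_diff[OF S(1), symmetric] cvec_pair.linear_neg[OF S(1), symmetric]
    cvec_pair.linear_scale[OF S(1), symmetric]
  have weight: "weight_space (S ` U) Y (S \<omega>) n = S ` weight_space U Y \<omega> n" for n
    by (auto simp: weight_space_def mode lin inj)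
  have alg: "vertex_algebra_on (S ` U) Y vac"
    by (intro vertex_subalgebra_vertex_algebra[OF Y] vertex_subalgebra_image[OF S(1,3,4) sub])
  obtain c where c: "\<forall>m n. \<forall>v\<in>U.
      virasoro_mode Y \<omega> m (virasoro_mode Y \<omega> n v) - virasoro_mode Y \<omega> n (virasoro_mode Y \<omega> m v)
        = of_int (m - n) *\<^sub>C virasoro_mode Y \<omega> (m + n) v
          + (if m + n = 0 then (of_int (m ^ 3 - m) / 12 * c) *\<^sub>C v else 0)"
    using U unfolding vertex_operator_algebra_on_def by (elim conjE exE) (rule that)
  have \<omega>: "\<omega> \<in> U"
    and deriv: "\<forall>v\<in>U. \<forall>w\<in>U. \<forall>n. Y (virasoro_mode Y \<omega> (- 1) v) n w = - (of_int n *\<^sub>C Y v (n - 1) w)"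
    and grading: "U = cvec.span (\<Union>n. weight_space U Y \<omega> n)"
    and fin: "\<forall>n. \<exists>B. finite B \<and> weight_space U Y \<omega> n \<subseteq> cvec.span B"
    and bounded: "\<exists>N. \<forall>n<N. weight_space U Y \<omega> n = {0}"
    using U unfolding vertex_operator_algebra_on_def by - (elim conjE, assumption)+
  have vir: "virasoro_mode Y (S \<omega>) m (virasoro_mode Y (S \<omega>) n (S v))
        - virasoro_mode Y (S \<omega>) n (virasoro_mode Y (S \<omega>) m (S v))
      = of_int (m - n) *\<^sub>C virasoro_mode Y (S \<omega>) (m + n) (S v)
        + (if m + n = 0 then (of_int (m ^ 3 - m) / 12 * c) *\<^sub>C S v else 0)" if "v \<in> U" for m n v
  proof -
    have 0: "(if m + n = 0 then S x else 0) = S (if m + n = 0 then x else 0)" for x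
      by (simp add: lin)
    show ?thesis
      by (simp only: mode lin(2-) 0 c[rule_format, OF that])
  qed
  have der: "Y (virasoro_mode Y (S \<omega>) (- 1) (S v)) n (S w) = - (of_int n *\<^sub>C Y (S v) (n - 1) (S w))"
    if "v \<in> U" "w \<in> U" for v w n
    by (simp only: mode hom lin(2-) deriv[rule_format, OF that])
  have gr: "S ` U = cvec.span (\<Union>n. weight_space (S ` U) Y (S \<omega>) n)"
    unfolding weight image_UN[symmetric] cvec_pair.linear_span_image[OF S(1)] grading[symmetric] ..
  have fi: "\<exists>B. finite B \<and> weight_space (S ` U) Y (S \<omega>) n \<subseteq> cvec.span B" for n
  proof -
    obtain B where "finite B" "weight_space U Y \<omega> n \<subseteq> cvec.span B" using fin by blast
    then have "finite (S ` B)" "weight_space (S ` U) Y (S \<omega>) n \<subseteq> cvec.span (S ` B)"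
      by (auto simp: weight cvec_pair.linear_span_image[OF S(1)])
    then show ?thesis by blast
  qed
  have bo: "\<exists>N. \<forall>n<N. weight_space (S ` U) Y (S \<omega>) n = {0}"
  proof -
    obtain N where "\<forall>n<N. weight_space U Y \<omega> n = {0}" using bounded by blast
    then show ?thesis by (intro exI[of _ N]) (simp add: weight lin(1))
  qed
  show ?thesis
    unfolding vertex_operator_algebra_on_def
  proof (intro conjI exI[of _ c] allI ballI alg gr fi bo)
    show "S \<omega> \<in> S ` U" using \<omega> by (rule imageI)
  qed (auto simp only: vir der elim!: imageE)
qed

text \<open>If \<open>U\<close> witnesses that \<open>\<omega>'\<close> is semi-conformal, then \<open>S ` U\<close> witnesses this for \<open>S \<omega>'\<close>. That
  \<open>S\<close> fixes \<open>\<omega>\<close> is what keeps the condition \<open>\<omega>'\<^sub>n = \<omega>\<^sub>n\<close> about the same \<open>\<omega>\<close>.\<close>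

lemma semiconformal_vectors_image:
  assumes Y: "vertex_algebra_on UNIV Y vac"
    and S: "clinear S" "inj S" "S vac = vac" "\<And>u. preserves_modes S Y u"
    and \<omega>: "S \<omega> = \<omega>" and \<omega>': "\<omega>' \<in> semiconformal_vectors Y vac \<omega>"
  shows "S \<omega>' \<in> semiconformal_vectors Y vac \<omega>"
proof -
  obtain U where U: "vertex_subalgebra U Y vac" "vertex_operator_algebra_on U Y vac \<omega>'"
    "\<And>n v. n \<ge> 0 \<Longrightarrow> v \<in> U \<Longrightarrow> Y \<omega>' n v = Y \<omega> n v"
    using \<omega>' unfolding semiconformal_vectors_def by blast
  have hom: "Y (S u) n (S v) = S (Y u n v)" for u n v
    using S(4) by (simp add: preserves_modes_def)
  have "Y (S \<omega>') n (S v) = Y \<omega> n (S v)" if "n \<ge> 0" "v \<in> U" for n v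
    using hom[of \<omega> n v] hom[of \<omega>' n v] U(3)[OF that] by (simp add: \<omega>)
  then show ?thesis
    unfolding semiconformal_vectors_def
    using vertex_subalgebra_image[OF S(1,3,4) U(1)] vertex_operator_algebra_image[OF Y S U(1,2)]
    by blast
qed

section \<open>The action on quadratic vectors\<close>

text \<open>Bilinearity of \<open>(a, b) \<mapsto> a(-1)b(-1)vac\<close> turns the substitution \<open>u\<^sub>j \<mapsto> \<Sum>\<^sub>i g\<^sub>i\<^sub>j u\<^sub>i\<close> into the congruence
  transformation of the coefficient matrix.\<close>

lemma quadratic_vector_automorphism:
  fixes act :: "'g::simple_lie_algebra affine \<Rightarrow> 'v::complex_vector \<Rightarrow> 'v"
    and u :: "'n::finite \<Rightarrow> 'g" and A g :: "complex^'n^'n"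
  assumes ind: "is_induced_module affine_bracket affine_nonneg (level_character l) act vac"
    and \<sigma>: "clinear \<sigma>" and g: "\<And>j. \<sigma> (u j) = (\<Sum>i\<in>UNIV. (g $ i $ j) *\<^sub>C u i)"
    and S: "clinear S" "S vac = vac" "\<And>X v. S (act X v) = act (affine_map \<sigma> X) (S v)"
  shows "S (quadratic_vector act vac u A) = quadratic_vector act vac u (g ** A ** transpose g)"
proof -
  define q where "q = (\<lambda>a b. act (loop a (- 1)) (act (loop b (- 1)) vac))"
  have lin_act: "clinear (act X)" for X by (rule induced_module_clinear[OF ind])
  have loop: "loop (a + b) n = loop a n + loop b n" "loop (c *\<^sub>C a) n = c *\<^sub>C loop a n"
    for a b :: 'g and c n
    by (rule affine_eqI; simp add: loop_def lookup_add lookup_single lookup_scaleC scaleC_prod_def when_def)+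
  have lin_loop: "clinear (\<lambda>a. act (loop a n) v)" for n v
    by (simp add: clinear_iff loop induced_module_add[OF ind] induced_module_scaleC[OF ind])
  have lin1: "clinear (\<lambda>a. q a b)" for b
    unfolding q_def by (rule lin_loop)
  have lin2: "clinear (q a)" for a
    using clinear_compose[OF lin_loop lin_act] unfolding q_def .
  have S_q: "S (q a b) = q (\<sigma> a) (\<sigma> b)" for a b
    by (simp add: q_def S affine_map_loop[OF \<sigma>])
  have expand: "q (\<sigma> (u i)) (\<sigma> (u j))
      = (\<Sum>k\<in>UNIV. \<Sum>m\<in>UNIV. (g $ k $ i * g $ m $ j) *\<^sub>C q (u k) (u m))" for i j
    by (simp only: g cvec_pair.linear_sum[OF lin1] cvec_pair.linear_sum[OF lin2]
        cvec_pair.linear_scale[OF lin1] cvec_pair.linear_scale[OF lin2]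
        cvec.scale_sum_right scaleC_scaleC)
      (subst sum.swap, simp only: mult.commute)
  have "S (quadratic_vector act vac u A)
      = (\<Sum>i\<in>UNIV. \<Sum>j\<in>UNIV. A $ i $ j *\<^sub>C S (q (u i) (u j)))"
    by (simp add: quadratic_vector_def q_def cvec_pair.linear_sum[OF S(1)] cvec_pair.linear_scale[OF S(1)])
  also have "\<dots> = (\<Sum>i\<in>UNIV. \<Sum>j\<in>UNIV. \<Sum>k\<in>UNIV. \<Sum>m\<in>UNIV.
      (g $ k $ i * A $ i $ j * g $ m $ j) *\<^sub>C q (u k) (u m))"
    by (simp add: S_q expand cvec.scale_sum_right scaleC_scaleC mult.assoc mult.left_commute)
  also have "\<dots> = (\<Sum>k\<in>UNIV. \<Sum>m\<in>UNIV. \<Sum>j\<in>UNIV. \<Sum>i\<in>UNIV.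
      (g $ k $ i * A $ i $ j * g $ m $ j) *\<^sub>C q (u k) (u m))"
  proof -
    have swap: "(\<Sum>i\<in>UNIV. \<Sum>j\<in>UNIV. \<Sum>k\<in>UNIV. \<Sum>m\<in>UNIV. f i j k m)
        = (\<Sum>k\<in>UNIV. \<Sum>m\<in>UNIV. \<Sum>j\<in>UNIV. \<Sum>i\<in>UNIV. f i j k m)" for f :: "'n \<Rightarrow> 'n \<Rightarrow> 'n \<Rightarrow> 'n \<Rightarrow> 'v"
      unfolding sum.cartesian_product
      by (rule sum.reindex_bij_witness[of _ "\<lambda>(k, m, j, i). (i, j, k, m)" "\<lambda>(i, j, k, m). (k, m, j, i)"]) auto
    show ?thesis by (rule swap)
  qed
  also have "\<dots> = quadratic_vector act vac u (g ** A ** transpose g)"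
    by (simp add: quadratic_vector_def q_def matrix_matrix_mult_def transpose_def
        cvec.scale_sum_left sum_distrib_right)
  finally show ?thesis .
qed

text \<open>The conformal vector is a multiple of \<open>\<omega>\<^sub>A\<close> for \<open>A\<close> the identity matrix, so it is fixed as soon as
  \<open>g g\<^sup>t\<^sup>r = 1\<close>.\<close>

lemma affine_conformal_vector_quadratic:
  fixes u :: "'n::finite \<Rightarrow> 'g::simple_lie_algebra"
  shows "affine_conformal_vector l act vac u
    = (1 / (2 * (l + dual_coxeter_number TYPE('g)))) *\<^sub>C
      quadratic_vector (act :: 'g affine \<Rightarrow> 'v::complex_vector \<Rightarrow> 'v) vac u (mat 1)"
proof -
  have "(if i = j then 1 else 0) *\<^sub>C x = (if i = j then x else 0)" for i j :: 'n and x :: 'v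
    by (simp add: scaleC_one)
  then show ?thesis
    by (simp add: affine_conformal_vector_def quadratic_vector_def mat_def)
qed

theorem proposition3p8:
  fixes l :: complex
    and act :: "'g::simple_lie_algebra affine \<Rightarrow> 'v::complex_vector \<Rightarrow> 'v"
    and vac :: 'v
    and Y :: "'v vertex_map"
    and u :: "'n::finite \<Rightarrow> 'g"
    and \<omega> :: 'v
    and A g :: "complex^'n^'n"
    and \<sigma> :: "'g \<Rightarrow> 'g"
  assumes "l \<noteq> - dual_coxeter_number TYPE('g)"
    and "orthonormal_basis u"
    and "is_universal_affine_voa l act vac Y"
    and "\<omega> = affine_conformal_vector l act vac u"
    and "transpose A = A"
    and "quadratic_vector act vac u A \<in> semiconformal_vectors Y vac \<omega>"
    and "lie_automorphism \<sigma>"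
    and "\<forall>j. \<sigma> (u j) = (\<Sum>i\<in>UNIV. (g $ i $ j) *\<^sub>C u i)"
  shows "automorphism_action act vac \<sigma> (quadratic_vector act vac u A)
      = quadratic_vector act vac u (g ** A ** transpose g)
      \<and> transpose (g ** A ** transpose g) = g ** A ** transpose g
      \<and> quadratic_vector act vac u (g ** A ** transpose g) \<in> semiconformal_vectors Y vac \<omega>"
proof -
  note voa = assms(3) and \<sigma> = assms(7)
  have ind: "is_induced_module affine_bracket affine_nonneg (level_character l) act vac"
    and Y: "vertex_algebra_on UNIV Y vac"
    using voa by (auto simp: is_universal_affine_voa_def)
  have lin: "clinear \<sigma>" using \<sigma> by (simp add: lie_automorphism_def)
  have g: "\<sigma> (u j) = (\<Sum>i\<in>UNIV. (g $ i $ j) *\<^sub>C u i)" for j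
    using assms(8) by blast
  obtain S where S: "clinear S" "bij S" "S vac = vac" "\<And>X v. S (act X v) = act (affine_map \<sigma> X) (S v)"
    using affine_module_automorphism[OF ind \<sigma>] by blast
  have inj: "inj S" using S(2) by (rule bij_is_inj)
  have quad: "S (quadratic_vector act vac u B) = quadratic_vector act vac u (g ** B ** transpose g)" for B
    by (rule quadratic_vector_automorphism[OF ind lin g S(1,3,4)])
  have modes: "preserves_modes S Y v" for v
    by (rule affine_module_automorphism_preserves_modes[OF voa lin S(1) inj S(3,4)])
  have "g ** mat 1 ** transpose g = mat 1"
    using automorphism_matrix_orthogonal[OF assms(2) \<sigma> g] by simp
  then have "S \<omega> = \<omega>"
    using quad[of "mat 1"] by (simp add: assms(4) affine_conformal_vector_quadratic cvec_pair.linear_scale[OF S(1)])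
  from semiconformal_vectors_image[OF Y S(1) inj S(3) modes this assms(6)]
  have "quadratic_vector act vac u (g ** A ** transpose g) \<in> semiconformal_vectors Y vac \<omega>"
    by (simp only: quad)
  moreover have "transpose (g ** A ** transpose g) = g ** A ** transpose g"
    by (simp add: matrix_transpose_mul assms(5) matrix_mul_assoc)
  moreover have "automorphism_action act vac \<sigma> = S"
    by (rule automorphism_action_eqI[OF ind lin S(1,3,4)])
  ultimately show ?thesis by (simp add: quad)
qed

end
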